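(* Let $(X,\mathrm{dist})$ be a metric space, $z\ge1$, and $k\ge1$ an integer. There is an algorithm that, given a finite dataset $P\subseteq X$, a center $c\in X$ and $0<\varepsilon<1$, computes a partition $\{W,Z\}$ of $P$ into two parts and a weighted point set $S\subseteq P$ with $|S|=3$ such that (1) $W$ is the union of $O(\log\frac{z}{\varepsilon})$ sets $R_i$, each $R_i\subseteq\mathrm{ring}(c,r_i,2r_i)$ for some $r_i>0$; and (2) $S$ is an $(\varepsilon,\mathrm{cost}_z(P,c))$-coreset for $(1,z)$-Clustering on $Z$. The algorithm runs in time $\tilde O(|P|k)$.
   Context: For $x\in X$, $\mathrm{cost}_z(Q,y)=\sum_{x\in Q}w_Q(x)\mathrm{dist}(x,y)^z$ for a finite weighted set $Q$ (unweighted sets have unit weights) and $y\in X$. For $u\in X$, $0\le a<b$: $\mathrm{ring}(u,a,b)=\{x\in X:a<\mathrm{dist}(x,u)\le b\}$. A weighted set $S$ is an $(\varepsilon,A)$-coreset for $(1,z)$-Clustering on $Z$ if for every $y\in X$, $|\mathrm{cost}_z(Z,y)-\mathrm{cost}_z(S,y)|\le\varepsilon(\mathrm{cost}_z(Z,y)+A)$. $\tilde O$ hides polylogarithmic factors.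
   Formalization: Since S ⊆ P cannot have three points when |P| < 3, the condition |S| = 3 is read as |S| = min(3, |P|); for |P| ≥ 3 it is |S| = 3 as stated. *)

theory Defs
  imports "HOL-Analysis.Analysis"
begin

section \<open>Clustering cost, rings and coresets\<close>

definition wcost :: "('a \<Rightarrow> 'a \<Rightarrow> real) \<Rightarrow> real \<Rightarrow> 'a set \<Rightarrow> ('a \<Rightarrow> real) \<Rightarrow> 'a \<Rightarrow> real" where
  "wcost d z Q w y = (\<Sum>x\<in>Q. w x * d x y powr z)"

abbreviation cost :: "('a \<Rightarrow> 'a \<Rightarrow> real) \<Rightarrow> real \<Rightarrow> 'a set \<Rightarrow> 'a \<Rightarrow> real" where
  "cost d z Q y \<equiv> wcost d z Q (\<lambda>_. 1) y"

definition metric_ring :: "'a set \<Rightarrow> ('a \<Rightarrow> 'a \<Rightarrow> real) \<Rightarrow> 'a \<Rightarrow> real \<Rightarrow> real \<Rightarrow> 'a set" where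
  "metric_ring X d u a b = {x \<in> X. a < d x u \<and> d x u \<le> b}"

definition weighted_set :: "'a set \<Rightarrow> ('a \<Rightarrow> real) \<Rightarrow> bool" where
  "weighted_set S w \<longleftrightarrow> finite S \<and> (\<forall>x\<in>S. 0 < w x)"

definition is_coreset ::
  "'a set \<Rightarrow> ('a \<Rightarrow> 'a \<Rightarrow> real) \<Rightarrow> real \<Rightarrow> real \<Rightarrow> real \<Rightarrow> 'a set \<Rightarrow> 'a set \<Rightarrow> ('a \<Rightarrow> real) \<Rightarrow> bool" where
  "is_coreset X d z \<epsilon> A Z S w \<longleftrightarrow> weighted_set S w \<and>
     (\<forall>y\<in>X. \<bar>cost d z Z y - wcost d z S w y\<bar> \<le> \<epsilon> * (cost d z Z y + A))"

section \<open>A unit-cost real RAM with distance queries\<close>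

text \<open>
  An algorithm is a program of the following imperative language. The memory consists of
  arrays of natural numbers and arrays of reals; array names are literals of the program, array
  indices are computed. Points are accessible only through their handles (natural numbers), by
  querying the distance of two of them. As usual for the real RAM, reals
  cannot be rounded to, or used as, natural numbers. Natural numbers can only be added,
  subtracted and compared, so unit cost is not abused through large products.
\<close>

datatype nexp =
    NConst nat
  | NGet nat nexp
  | NAdd nexp nexp
  | NSub nexp nexp

datatype rexp =
    RNat nexp
  | RGet nat nexp
  | RDist nexp nexp
  | RAdd rexp rexp
  | RSub rexp rexp
  | RMul rexp rexp
  | RDiv rexp rexp
  | RPow rexp rexp

datatype bexp =
    NLess nexp nexp
  | RLess rexp rexp
  | BNot bexp
  | BAnd bexp bexp

datatype com =
    Skip
  | NPut nat nexp nexp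
  | RPut nat nexp rexp
  | Seq com com
  | Cond bexp com com
  | While bexp com

record state =
  nats :: "nat \<Rightarrow> nat \<Rightarrow> nat"
  reals :: "nat \<Rightarrow> nat \<Rightarrow> real"

type_synonym queries = "nat \<Rightarrow> nat \<Rightarrow> real"

primrec nval :: "nexp \<Rightarrow> state \<Rightarrow> nat" where
  "nval (NConst n) s = n"
| "nval (NGet A e) s = nats s A (nval e s)"
| "nval (NAdd e f) s = nval e s + nval f s"
| "nval (NSub e f) s = nval e s - nval f s"

primrec rval :: "queries \<Rightarrow> rexp \<Rightarrow> state \<Rightarrow> real" where
  "rval \<delta> (RNat e) s = real (nval e s)"
| "rval \<delta> (RGet A e) s = reals s A (nval e s)"
| "rval \<delta> (RDist e f) s = \<delta> (nval e s) (nval f s)"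
| "rval \<delta> (RAdd a b) s = rval \<delta> a s + rval \<delta> b s"
| "rval \<delta> (RSub a b) s = rval \<delta> a s - rval \<delta> b s"
| "rval \<delta> (RMul a b) s = rval \<delta> a s * rval \<delta> b s"
| "rval \<delta> (RDiv a b) s = rval \<delta> a s / rval \<delta> b s"
| "rval \<delta> (RPow a b) s = rval \<delta> a s powr rval \<delta> b s"

primrec bval :: "queries \<Rightarrow> bexp \<Rightarrow> state \<Rightarrow> bool" where
  "bval \<delta> (NLess e f) s \<longleftrightarrow> nval e s < nval f s"
| "bval \<delta> (RLess a b) s \<longleftrightarrow> rval \<delta> a s < rval \<delta> b s"
| "bval \<delta> (BNot p) s \<longleftrightarrow> \<not> bval \<delta> p s"
| "bval \<delta> (BAnd p q) s \<longleftrightarrow> bval \<delta> p s \<and> bval \<delta> q s"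

text \<open>Every constant, memory access, distance query, arithmetic operation and test costs one step.\<close>

primrec ntime :: "nexp \<Rightarrow> nat" where
  "ntime (NConst n) = 1"
| "ntime (NGet A e) = ntime e + 1"
| "ntime (NAdd e f) = ntime e + ntime f + 1"
| "ntime (NSub e f) = ntime e + ntime f + 1"

primrec rtime :: "rexp \<Rightarrow> nat" where
  "rtime (RNat e) = ntime e + 1"
| "rtime (RGet A e) = ntime e + 1"
| "rtime (RDist e f) = ntime e + ntime f + 1"
| "rtime (RAdd a b) = rtime a + rtime b + 1"
| "rtime (RSub a b) = rtime a + rtime b + 1"
| "rtime (RMul a b) = rtime a + rtime b + 1"
| "rtime (RDiv a b) = rtime a + rtime b + 1"
| "rtime (RPow a b) = rtime a + rtime b + 1"

primrec btime :: "bexp \<Rightarrow> nat" where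
  "btime (NLess e f) = ntime e + ntime f + 1"
| "btime (RLess a b) = rtime a + rtime b + 1"
| "btime (BNot p) = btime p + 1"
| "btime (BAnd p q) = btime p + btime q + 1"

definition nput :: "nat \<Rightarrow> nat \<Rightarrow> nat \<Rightarrow> state \<Rightarrow> state" where
  "nput A i v s = s\<lparr>nats := (nats s)(A := (nats s A)(i := v))\<rparr>"

definition rput :: "nat \<Rightarrow> nat \<Rightarrow> real \<Rightarrow> state \<Rightarrow> state" where
  "rput A i v s = s\<lparr>reals := (reals s)(A := (reals s A)(i := v))\<rparr>"

text \<open>\<open>exec \<delta> p s t s'\<close>: started in \<open>s\<close>, program \<open>p\<close> halts in \<open>s'\<close> after exactly \<open>t\<close> steps.\<close>

inductive exec :: "queries \<Rightarrow> com \<Rightarrow> state \<Rightarrow> nat \<Rightarrow> state \<Rightarrow> bool" for \<delta> :: queries where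
  Skip: "exec \<delta> Skip s 1 s"
| NPut: "exec \<delta> (NPut A i e) s (ntime i + ntime e + 1) (nput A (nval i s) (nval e s) s)"
| RPut: "exec \<delta> (RPut A i e) s (ntime i + rtime e + 1) (rput A (nval i s) (rval \<delta> e s) s)"
| Seq: "exec \<delta> p s t s' \<Longrightarrow> exec \<delta> q s' t' s'' \<Longrightarrow> exec \<delta> (Seq p q) s (t + t') s''"
| CondTrue: "bval \<delta> b s \<Longrightarrow> exec \<delta> p s t s' \<Longrightarrow> exec \<delta> (Cond b p q) s (btime b + t + 1) s'"
| CondFalse: "\<not> bval \<delta> b s \<Longrightarrow> exec \<delta> q s t s' \<Longrightarrow> exec \<delta> (Cond b p q) s (btime b + t + 1) s'"
| WhileFalse: "\<not> bval \<delta> b s \<Longrightarrow> exec \<delta> (While b p) s (btime b + 1) s"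
| WhileTrue: "bval \<delta> b s \<Longrightarrow> exec \<delta> p s t s' \<Longrightarrow> exec \<delta> (While b p) s' t' s'' \<Longrightarrow>
    exec \<delta> (While b p) s (btime b + t + t' + 1) s''"

inductive_cases exec_SkipE: "exec \<delta> Skip s t s'"
inductive_cases exec_NPutE: "exec \<delta> (NPut A i e) s t s'"
inductive_cases exec_RPutE: "exec \<delta> (RPut A i e) s t s'"
inductive_cases exec_SeqE: "exec \<delta> (Seq p q) s t s'"
inductive_cases exec_CondE: "exec \<delta> (Cond b p q) s t s'"
inductive_cases exec_WhileE: "exec \<delta> (While b p) s t s'"

lemma exec_deterministic:
  "exec \<delta> p s t s' \<Longrightarrow> exec \<delta> p s u s'' \<Longrightarrow> u = t \<and> s'' = s'"
proof (induction arbitrary: u s'' rule: exec.induct)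
  case Skip
  then show ?case by (auto elim: exec_SkipE)
next
  case NPut
  then show ?case by (auto elim: exec_NPutE)
next
  case RPut
  then show ?case by (auto elim: exec_RPutE)
next
  case (Seq p s t s' q t' s2)
  from Seq.prems obtain v v' r where
    "exec \<delta> p s v r" "exec \<delta> q r v' s''" "u = v + v'"
    by (rule exec_SeqE)
  then show ?case using Seq.IH by metis
next
  case (CondTrue b s p t s' q)
  from CondTrue.prems CondTrue.hyps(1) obtain v where
    "exec \<delta> p s v s''" "u = btime b + v + 1"
    by (elim exec_CondE) auto
  then show ?case using CondTrue.IH by metis
next
  case (CondFalse b s q t s' p)
  from CondFalse.prems CondFalse.hyps(1) obtain v where
    "exec \<delta> q s v s''" "u = btime b + v + 1"
    by (elim exec_CondE) auto
  then show ?case using CondFalse.IH by metis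
next
  case (WhileFalse b s p)
  from WhileFalse.prems show ?case by (rule exec_WhileE) (use WhileFalse.hyps in simp_all)
next
  case (WhileTrue b s p t s' t' s2)
  from WhileTrue.prems obtain v v' r where
    "exec \<delta> p s v r" "exec \<delta> (While b p) r v' s''" "u = btime b + v + v' + 1"
    by (rule exec_WhileE) (use WhileTrue.hyps(1) in simp_all)
  then show ?case using WhileTrue.IH by metis
qed

section \<open>Input and output conventions\<close>

text \<open>
  The dataset is presented as a list \<open>xs\<close> without repetitions. Handle \<open>i < length xs\<close> stands
  for the point \<open>xs ! i\<close>, handle \<open>length xs\<close> for the center \<open>c\<close>.
\<close>

definition handle_dist :: "('a \<Rightarrow> 'a \<Rightarrow> real) \<Rightarrow> 'a list \<Rightarrow> 'a \<Rightarrow> queries" where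
  "handle_dist d xs c i j =
     (if i \<le> length xs \<and> j \<le> length xs then d ((xs @ [c]) ! i) ((xs @ [c]) ! j) else 0)"

definition init_state :: "nat \<Rightarrow> nat \<Rightarrow> real \<Rightarrow> real \<Rightarrow> state" where
  "init_state n k z \<epsilon> =
     \<lparr>nats = (\<lambda>_ _. 0)(0 := (\<lambda>_. 0)(0 := n, 1 := k)),
      reals = (\<lambda>_ _. 0)(0 := (\<lambda>_. 0)(0 := z, 1 := \<epsilon>))\<rparr>"

text \<open>
  On halting, array 1 of the natural numbers labels the points of the dataset (0 for \<open>W\<close>, 1 for
  \<open>Z\<close>), and array 1 of the reals holds their weights in \<open>S\<close>, points outside \<open>S\<close> having entry 0.
\<close>

definition outputs ::
  "'a list \<Rightarrow> state \<Rightarrow> 'a set \<Rightarrow> 'a set \<Rightarrow> 'a set \<Rightarrow> ('a \<Rightarrow> real) \<Rightarrow> bool" where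
  "outputs xs s W Z S w \<longleftrightarrow>
     W = {xs ! i | i. i < length xs \<and> nats s 1 i = 0} \<and>
     Z = {xs ! i | i. i < length xs \<and> nats s 1 i = 1} \<and>
     S = {xs ! i | i. i < length xs \<and> reals s 1 i \<noteq> 0} \<and>
     (\<forall>i < length xs. w (xs ! i) = reals s 1 i)"

end

theory Submission
  imports Defs
begin

text \<open>
  Write \<open>n\<close> for the number of points, \<open>f x = dist(x, c)\<close>, \<open>A\<close> for the cost of \<open>c\<close>, and put
  \<open>Q = 100 z / \<epsilon>\<close>, \<open>L = Q\<^sup>-\<^sup>2\<^sup>z\<close>. Up to three points are their own coreset, so let \<open>n \<ge> 4\<close>.

  The error is measured against the cost of \<open>Z\<close>, not of the whole dataset. The points of large
  distance are negligible for a center \<open>y\<close> far from \<open>c\<close> only if \<open>Z\<close> also contains many points near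
  \<open>c\<close>. Therefore \<open>Z\<close> consists of the far points \<open>H\<close>, where \<open>n f\<^sup>z > A / L\<^sup>2\<close>, and of a set \<open>G\<close>: the
  nearest point \<open>a\<close>, all points with \<open>n f\<^sup>z \<le> L A\<close>, and greedily chosen points with \<open>n f\<^sup>z \<le> 2 A\<close>
  as long as their accumulated cost stays below \<open>L A\<close>. The cost of \<open>G - {a}\<close> is at most \<open>2 L A\<close>, so
  \<open>G\<close> may be moved to \<open>a\<close>. If \<open>H\<close> is nonempty then \<open>|G| \<ge> n L / 4\<close>, and \<open>H\<close> is represented by the
  furthest point \<open>b\<close> with a weight that preserves the cost of \<open>c\<close>. A weight \<open>L\<close> is added to \<open>a\<close>, \<open>b\<close> and
  a third point; since \<open>a \<in> Z\<close>, this is absorbed by the error. All other points have distance between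
  \<open>\<rho>\<close> and \<open>\<rho> Q\<^sup>6\<close> from \<open>c\<close>, where \<open>\<rho>\<^sup>z = L A / n\<close>.

  If \<open>z / \<epsilon>\<close> is close to 1, the bound on the number of rings forces \<open>W\<close> to be empty. There the error
  is so generous that weight \<open>n / 10\<close> on \<open>a\<close> and \<open>1 / 100\<close> on two other points suffice for the whole
  dataset.
\<close>

section \<open>Error estimates\<close>

lemma powr_add_le_max:
  fixes u v z :: real
  assumes "0 \<le> u" "0 \<le> v" "1 \<le> z"
  shows "(u + v) powr z \<le> 2 powr z * (u powr z + v powr z)"
proof -
  have "(u + v) powr z \<le> (2 * max u v) powr z"
    using assms by (intro powr_mono2) auto
  also have "\<dots> = 2 powr z * max u v powr z"
    using assms by (simp add: powr_mult)
  also have "\<dots> \<le> 2 powr z * (u powr z + v powr z)"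
    by (intro mult_left_mono) (auto simp: max_def)
  finally show ?thesis .
qed

text \<open>If \<open>v\<close> is at most \<open>\<delta> / (2 * z) * u\<close>, the factor (1 +
  \<delta>/(2z))^z is at most exp(\<delta>/2), hence at most 1 + \<delta>. Otherwise
  \<open>u\<close> is at most \<open>2 * z / \<delta> * v\<close>, and the whole power is charged to
  \<open>v\<close>.\<close>

lemma powr_add_le:
  fixes u v z \<delta> :: real
  assumes "0 \<le> u" "0 \<le> v" "1 \<le> z" "0 < \<delta>" "\<delta> \<le> 1"
  shows "(u + v) powr z \<le> (1 + \<delta>) * u powr z + (1 + 2 * z / \<delta>) powr z * v powr z"
proof (cases "v \<le> \<delta> / (2 * z) * u")
  case True
  have "(1 + \<delta> / (2 * z)) powr z \<le> exp (\<delta> / (2 * z)) powr z"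
    using assms by (intro powr_mono2 exp_ge_add_one_self) auto
  also have "\<dots> = exp (\<delta> / 2)"
    using assms by (simp add: exp_powr_real)
  also have "\<dots> \<le> 1 + \<delta> / 2 + (\<delta> / 2)\<^sup>2"
    using assms by (intro exp_bound) auto
  also have "\<dots> \<le> 1 + \<delta>"
    using assms by (simp add: power2_eq_square field_simps)
  finally have *: "(1 + \<delta> / (2 * z)) powr z \<le> 1 + \<delta>" .
  have "(u + v) powr z \<le> ((1 + \<delta> / (2 * z)) * u) powr z"
    using True assms by (intro powr_mono2) (auto simp: algebra_simps)
  also have "\<dots> = (1 + \<delta> / (2 * z)) powr z * u powr z"
    using assms by (simp add: powr_mult)
  also have "\<dots> \<le> (1 + \<delta>) * u powr z"
    using * by (intro mult_right_mono) auto
  also have "\<dots> \<le> (1 + \<delta>) * u powr z + (1 + 2 * z / \<delta>) powr z * v powr z"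
    by simp
  finally show ?thesis .
next
  case False
  then have "u \<le> 2 * z / \<delta> * v"
    using assms by (simp add: field_simps)
  then have "(u + v) powr z \<le> ((1 + 2 * z / \<delta>) * v) powr z"
    using assms by (intro powr_mono2) (auto simp: algebra_simps)
  also have "\<dots> = (1 + 2 * z / \<delta>) powr z * v powr z"
    using assms by (simp add: powr_mult)
  also have "\<dots> \<le> (1 + \<delta>) * u powr z + (1 + 2 * z / \<delta>) powr z * v powr z"
    using assms by simp
  finally show ?thesis .
qed

text \<open>
  Here \<open>f\<close> and \<open>g\<close> are the distances of the points to \<open>c\<close> and to some \<open>y\<close>, and \<open>D\<close> is the distance
  of \<open>c\<close> and \<open>y\<close>.
\<close>

locale star_distances =
  fixes n :: nat and f g :: "nat \<Rightarrow> real" and D z \<epsilon> :: real and a b e :: nat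
  assumes z: "1 \<le> z" and eps: "0 < \<epsilon>" "\<epsilon> < 1"
    and f_nonneg: "\<And>i. i < n \<Longrightarrow> 0 \<le> f i"
    and g_nonneg: "\<And>i. i < n \<Longrightarrow> 0 \<le> g i"
    and D_nonneg: "0 \<le> D"
    and g_le: "\<And>i. i < n \<Longrightarrow> g i \<le> f i + D"
    and f_le: "\<And>i. i < n \<Longrightarrow> f i \<le> g i + D"
    and D_le: "\<And>i. i < n \<Longrightarrow> D \<le> f i + g i"
    and g_le_g: "\<And>i j. i < n \<Longrightarrow> j < n \<Longrightarrow> g i \<le> g j + (f i + f j)"
    and abe: "a < n" "b < n" "e < n"
    and nearest: "\<And>i. i < n \<Longrightarrow> f a \<le> f i"
    and furthest: "\<And>i. i < n \<Longrightarrow> f i \<le> f b"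
begin

abbreviation "A \<equiv> \<Sum>i<n. f i powr z"

section \<open>Error bounds for a fixed center y\<close>

lemma powr_f_le_A: "i < n \<Longrightarrow> f i powr z \<le> A"
  by (intro member_le_sum) auto

text \<open>The minimum is at most the average.\<close>

lemma nearest_powr: "real n * f a powr z \<le> A"
proof -
  have "(\<Sum>i<n. f a powr z) \<le> A"
    using abe nearest f_nonneg z by (intro sum_mono powr_mono2) auto
  then show ?thesis by simp
qed

lemma powr_g_le: "i < n \<Longrightarrow> g i powr z \<le> 2 powr z * (f i powr z + D powr z)"
  using powr_mono2[of z "g i" "f i + D"] powr_add_le_max[of "f i" D z] z g_le g_nonneg f_nonneg D_nonneg
  by (meson dual_order.trans less_eq_real_def zero_less_one)

lemma powr_D_le: "i < n \<Longrightarrow> D powr z \<le> 2 powr z * (f i powr z + g i powr z)"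
  using powr_mono2[of z D "f i + g i"] powr_add_le_max[of "f i" "g i" z] z D_le g_nonneg f_nonneg D_nonneg
  by (meson dual_order.trans less_eq_real_def zero_less_one)

text \<open>Together with 1 \<le> z and \<epsilon> < 1 the hypothesis forces z < 101/100 and
  \<epsilon> \<ge> 99/100, so the triangle inequalities for powers hold with the factor 11/5. The
  weight n/10 is large enough for the cost of \<open>a\<close> to follow a large total cost, and
  small enough not to overshoot it by more than the error allows.\<close>

lemma crude_coreset:
  assumes small: "z < 101/100 * \<epsilon>"
  shows "\<bar>(\<Sum>i<n. g i powr z) - (real n / 10 * g a powr z + 1/100 * g b powr z + 1/100 * g e powr z)\<bar>
    \<le> \<epsilon> * ((\<Sum>i<n. g i powr z) + A)"
proof -
  define F where "F = (\<Sum>i<n. g i powr z)"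
  \<comment> \<open>Since 2 < (11/10)^8, the power 2^(9/8) is at most 11/5, and z < 101/100 lies
    below 9/8.\<close>
  have "2 powr (1/8::real) \<le> ((11/10) powr real 8) powr (1/8)"
    by (intro powr_mono2, simp_all only: powr_realpow) (auto simp: power_numeral_reduce)
  also have "\<dots> = 11/10"
    by (simp only: powr_powr) simp
  finally have "2 powr (1 + 1/8::real) \<le> 11/5"
    by (subst powr_add) simp
  moreover have "2 powr z \<le> 2 powr (1 + 1/8)"
    using small eps z by (intro powr_mono) auto
  ultimately have beta: "2 powr z \<le> 11/5" by linarith
  have bound: "2 powr z * (u + v) \<le> 11/5 * (u + v)" if "0 \<le> u" "0 \<le> v" for u v :: real
    using that beta by (intro mult_right_mono) auto
  have g1: "g i powr z \<le> 11/5 * (f i powr z + D powr z)" if "i < n" for i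
    using powr_g_le[OF that] bound[of "f i powr z" "D powr z"] by simp
  have D1: "D powr z \<le> 11/5 * (f i powr z + g i powr z)" if "i < n" for i
    using powr_D_le[OF that] bound[of "f i powr z" "g i powr z"] by simp
  have n1: "1 \<le> real n" using abe by simp
  have "F \<le> (\<Sum>i<n. 11/5 * (f i powr z + D powr z))"
    unfolding F_def using g1 by (intro sum_mono) auto
  then have F: "F \<le> 11/5 * (A + real n * D powr z)"
    by (simp only: sum.distrib sum_constant card_lessThan flip: sum_distrib_left)
  have "(\<Sum>i<n. D powr z) \<le> (\<Sum>i<n. 11/5 * (f i powr z + g i powr z))"
    using D1 by (intro sum_mono) auto
  then have nD: "real n * D powr z \<le> 11/5 * (A + F)"
    by (simp only: sum.distrib sum_constant card_lessThan F_def flip: sum_distrib_left)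
  have D: "D powr z \<le> real n * D powr z"
    using n1 by (simp add: mult_le_cancel_right1)
  have "real n * g a powr z \<le> real n * (11/5 * (f a powr z + D powr z))"
    using g1[of a] abe by (intro mult_left_mono) auto
  then have ga: "real n * g a powr z \<le> 11/5 * (A + real n * D powr z)"
    using nearest_powr by (simp add: algebra_simps)
  have "real n * D powr z \<le> real n * (11/5 * (f a powr z + g a powr z))"
    using D1[of a] abe by (intro mult_left_mono) auto
  then have nDa: "real n * D powr z \<le> 11/5 * (A + real n * g a powr z)"
    using nearest_powr by (simp add: algebra_simps)
  have gb: "g b powr z \<le> 11/5 * (A + D powr z)" "g e powr z \<le> 11/5 * (A + D powr z)"
    using g1[of b] g1[of e] powr_f_le_A[of b] powr_f_le_A[of e] abe by auto
  have pos: "0 \<le> A" "0 \<le> F" "0 \<le> g a powr z" "0 \<le> g b powr z" "0 \<le> g e powr z"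
    by (auto simp: F_def intro!: sum_nonneg)
  have "99/100 \<le> \<epsilon>" using small z by simp
  then have "99/100 * (F + A) \<le> \<epsilon> * (F + A)"
    using pos by (intro mult_right_mono) auto
  moreover have "\<bar>F - (real n * g a powr z / 10 + g b powr z / 100 + g e powr z / 100)\<bar>
      \<le> 99/100 * (F + A)"
  proof -
    \<comment> \<open>With \<open>B\<close> for A, \<open>v\<close> for n D^z, \<open>t\<close> for
      D^z, \<open>u\<close> for n times the cost of \<open>a\<close>, and \<open>p\<close>,
      \<open>q\<close> for the costs of \<open>b\<close> and \<open>e\<close>, only linear
      inequalities remain.\<close>
    have "\<bar>F - (u / 10 + p / 100 + q / 100)\<bar> \<le> 99/100 * (F + B)"
      if "F \<le> 11/5 * (B + v)" "v \<le> 11/5 * (B + F)" "t \<le> v" "u \<le> 11/5 * (B + v)"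
        "v \<le> 11/5 * (B + u)" "p \<le> 11/5 * (B + t)" "q \<le> 11/5 * (B + t)"
        "0 \<le> B" "0 \<le> F" "0 \<le> p" "0 \<le> q" "0 \<le> u"
      for B u v t p q
      using that by (simp add: field_simps)
    from this[OF F nD D ga nDa gb pos(1,2,4,5)] show ?thesis by simp
  qed
  ultimately show ?thesis
    by (simp add: F_def)
qed

text \<open>The error has three sources, all measured against the cost of Z plus A. Moving
  \<open>G - {a}\<close> to \<open>a\<close> is cheap by \<open>G_cost\<close>; \<open>H\<close> and
  its representative \<open>b\<close> are both compared with the cost of \<open>H\<close> at c; the
  added weights \<open>L\<close> are absorbed because \<open>a\<close> is in Z. The maximality
  \<open>G_full\<close> makes \<open>G\<close> so large that a remote y is already expensive on
  \<open>G\<close>.\<close>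

lemma fine_coreset:
  assumes L: "L = (100 * z / \<epsilon>) powr (- 2 * z)"
    and A: "0 < A"
    and G: "G \<subseteq> {..<n}" "a \<in> G"
    and G_near: "\<And>i. i \<in> G - {a} \<Longrightarrow> real n * f i powr z \<le> 2 * A"
    and G_cost: "(\<Sum>i\<in>G - {a}. f i powr z) \<le> 2 * L * A"
    and G_full: "\<And>i. i < n \<Longrightarrow> real n * f i powr z \<le> 2 * A \<Longrightarrow>
      i \<in> G \<or> L * A < (\<Sum>i\<in>G - {a}. f i powr z) + f i powr z"
    and H: "H \<subseteq> {..<n}" "\<And>i. i \<in> H \<Longrightarrow> A < L\<^sup>2 * (real n * f i powr z)"
    and disj: "G \<inter> H = {}"
  shows "\<bar>(\<Sum>i\<in>G \<union> H. g i powr z) - ((real (card G) + L) * g a powr z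
      + ((\<Sum>i\<in>H. f i powr z) / f b powr z + L) * g b powr z + L * g e powr z)\<bar>
    \<le> \<epsilon> * ((\<Sum>i\<in>G \<union> H. g i powr z) + A)"
proof -
  define \<delta> where "\<delta> = \<epsilon> / 8"
  define M where "M = (1 + 2 * z / \<delta>) powr z"
  \<comment> \<open>The factor 100 lets \<open>T\<close> dominate the constant
    \<open>M * 2 powr z\<close> of the triangle inequalities, while \<open>L * T\<close> is at most
    \<epsilon>/100. One factor \<open>L\<close> therefore pays for one such constant and leaves a
    small multiple of \<epsilon>.\<close>
  define Q where "Q = 100 * z / \<epsilon>"
  define T where "T = Q powr z"
  define FG where "FG = (\<Sum>i\<in>G - {a}. g i powr z)"
  define FH where "FH = (\<Sum>i\<in>H. g i powr z)"
  define AG where "AG = (\<Sum>i\<in>G - {a}. f i powr z)"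
  define AH where "AH = (\<Sum>i\<in>H. f i powr z)"
  define N where "N = real (card (G - {a}))"
  define w where "w = AH / f b powr z"
  define U where "U = FG + g a powr z + FH + A"
  have fin: "finite G" "finite H" using finite_subset[OF G(1)] finite_subset[OF H(1)] by auto
  have n: "0 < real n" using abe by simp
  have delta: "0 < \<delta>" "\<delta> \<le> 1" using eps by (auto simp: \<delta>_def)
  have Q: "100 / \<epsilon> \<le> Q" "100 \<le> Q" using z eps by (auto simp: Q_def field_simps)
  have "Q powr 1 \<le> T" unfolding T_def using Q z by (intro powr_mono) auto
  then have "Q \<le> T" using Q by (subst (asm) powr_one) auto
  then have T: "100 / \<epsilon> \<le> T" "100 \<le> T" using Q by auto
  have LT: "L = 1 / T\<^sup>2"
    by (simp add: L T_def Q_def powr_minus_divide power2_eq_square flip: powr_add)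
  have L_pos: "0 < L" using T by (simp add: LT)
  have LT1: "L * T = 1 / T" using T unfolding LT by (simp add: power2_eq_square)
  have invT: "1 / T \<le> \<epsilon> / 100" using T eps by (simp add: field_simps)
  have invL: "10000 \<le> 1 / L" using mult_mono[OF T(2) T(2)] T unfolding LT by (simp add: power2_eq_square)
  have L1: "L \<le> 1" using invL L_pos by (simp add: field_simps)
  have M0: "0 \<le> M" by (simp add: M_def)
  \<comment> \<open>As z/\<epsilon> \<ge> 1, the base 4 (1 + 16 z/\<epsilon>) is at most 68
    z/\<epsilon> and thus below \<open>Q\<close>.\<close>
  have MT: "2 * (M * 2 powr z) \<le> T"
  proof -
    have "2 powr 1 \<le> 2 powr z" using z by (intro powr_mono) auto
    then have "2 * (M * 2 powr z) \<le> 2 powr z * (M * 2 powr z)"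
      using M0 by (intro mult_right_mono) auto
    also have "\<dots> = (4 * (1 + 2 * z / \<delta>)) powr z"
      using z delta powr_mult[of 2 2 z] by (subst powr_mult) (auto simp: M_def)
    also have "\<dots> \<le> T"
      unfolding T_def using z eps by (intro powr_mono2) (auto simp: Q_def \<delta>_def field_simps)
    finally show ?thesis .
  qed
  have T4: "2 powr z * 2 powr z \<le> T"
    using Q z powr_mono2[of z 4 Q] powr_mult[of 2 2 z] by (simp add: T_def)
  have p2: "1 \<le> 2 powr z" using z by (simp add: ge_one_powr_ge_zero)

  have A_sub: "(\<Sum>i\<in>B. f i powr z) \<le> A" if "B \<subseteq> {..<n}" for B
    using that by (intro sum_mono2) auto
  have nonneg: "0 \<le> FG" "0 \<le> FH" "0 \<le> AG" "0 \<le> AH" "0 \<le> N" "0 \<le> w"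
    by (auto simp: FG_def FH_def AG_def AH_def N_def w_def intro!: sum_nonneg divide_nonneg_nonneg)
  have AH_le: "AH \<le> A" unfolding AH_def using H by (intro A_sub)
  have sum_G: "(\<Sum>i\<in>G. h i) = h a + (\<Sum>i\<in>G - {a}. h i)" for h :: "nat \<Rightarrow> real"
    by (rule sum.remove[OF fin(1) G(2)])
  have card_G: "real (card G) = N + 1"
    using card.remove[OF fin(1) G(2)] by (simp add: N_def)
  have sum_GH: "(\<Sum>i\<in>G \<union> H. g i powr z) = FG + g a powr z + FH"
    using fin disj by (simp add: sum.union_disjoint sum_G FG_def FH_def)

  have close: "u powr z \<le> (1 + \<delta>) * v powr z + M * t powr z"
    if "u \<le> v + t" "0 \<le> u" "0 \<le> v" "0 \<le> t" for u v t
  proof -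
    have "u powr z \<le> (v + t) powr z" using that z by (intro powr_mono2) auto
    also have "\<dots> \<le> (1 + \<delta>) * v powr z + M * t powr z"
      unfolding M_def using that z delta by (intro powr_add_le) auto
    finally show ?thesis .
  qed

  \<comment> \<open>Moving \<open>i\<close> to \<open>a\<close> covers a distance of at most
    \<open>f i + f a\<close>, which is at most \<open>2 * f i\<close> because \<open>a\<close> is
    nearest to c.\<close>
  have inner: "\<bar>FG - N * g a powr z\<bar> \<le> \<epsilon> / 4 * FG + \<epsilon> / 50 * A"
  proof -
    let ?M = "M * 2 powr z"
    have *: "M * (f i + f a) powr z \<le> ?M * f i powr z" if "i < n" for i
    proof -
      have "(f i + f a) powr z \<le> (2 * f i) powr z"
        using that z nearest[OF that] f_nonneg abe by (intro powr_mono2) auto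
      also have "\<dots> = 2 powr z * f i powr z" using f_nonneg[OF that] by (simp add: powr_mult)
      finally show ?thesis using mult_left_mono[OF _ M0] by (simp add: mult.assoc)
    qed
    have 1: "g i powr z \<le> (1 + \<delta>) * g a powr z + ?M * f i powr z"
      and 2: "g a powr z \<le> (1 + \<delta>) * g i powr z + ?M * f i powr z" if "i \<in> G - {a}" for i
    proof -
      have i: "i < n" using that G by auto
      show "g i powr z \<le> (1 + \<delta>) * g a powr z + ?M * f i powr z"
        using close[of "g i" "g a" "f i + f a"] *[OF i] g_le_g[OF i abe(1)] i abe g_nonneg f_nonneg
        by (force intro: order_trans)
      show "g a powr z \<le> (1 + \<delta>) * g i powr z + ?M * f i powr z"
        using close[of "g a" "g i" "f i + f a"] *[OF i] g_le_g[OF abe(1) i] i abe g_nonneg f_nonneg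
        by (force simp: add.commute intro: order_trans)
    qed
    have "FG \<le> (\<Sum>i\<in>G - {a}. (1 + \<delta>) * g a powr z + ?M * f i powr z)"
      unfolding FG_def using 1 by (intro sum_mono)
    also have "\<dots> = N * ((1 + \<delta>) * g a powr z) + ?M * AG"
      by (simp only: sum.distrib sum_constant AG_def N_def flip: sum_distrib_left)
    finally have 3: "FG \<le> (1 + \<delta>) * (N * g a powr z) + ?M * AG" by (simp add: mult_ac)
    have "(\<Sum>i\<in>G - {a}. g a powr z) \<le> (\<Sum>i\<in>G - {a}. (1 + \<delta>) * g i powr z + ?M * f i powr z)"
      using 2 by (intro sum_mono)
    then have 4: "N * g a powr z \<le> (1 + \<delta>) * FG + ?M * AG"
      by (simp only: sum.distrib sum_constant AG_def FG_def N_def flip: sum_distrib_left)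
    \<comment> \<open>The error in 3 is a multiple of the cost of \<open>a\<close>; inequality 4
      turns it into a multiple of \<open>FG\<close>, as the claim allows.\<close>
    have "\<delta> * (N * g a powr z) \<le> \<delta> * ((1 + \<delta>) * FG + ?M * AG)"
      using 4 delta by (intro mult_left_mono) auto
    also have "\<dots> = \<delta> * FG + \<delta> * (\<delta> * FG) + \<delta> * (?M * AG)" by (simp add: algebra_simps)
    also have "\<dots> \<le> \<delta> * FG + \<delta> * FG + ?M * AG"
      using delta nonneg M0 by (intro add_mono mult_left_le_one_le order_refl) auto
    finally have 5: "\<delta> * (N * g a powr z) \<le> 2 * (\<delta> * FG) + ?M * AG" by linarith
    have "2 * ?M * AG \<le> T * (2 * L * A)"
      using MT G_cost nonneg T by (intro mult_mono) (auto simp: AG_def)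
    also have "\<dots> = 2 * (L * T) * A" by simp
    also have "\<dots> = 2 * (1 / T) * A" unfolding LT1 ..
    also have "\<dots> \<le> 2 * (\<epsilon> / 100) * A" using invT A by (intro mult_right_mono mult_left_mono) auto
    finally have 6: "2 * (?M * AG) \<le> \<epsilon> / 50 * A" by simp
    have 7: "2 * (\<delta> * FG) = \<epsilon> / 4 * FG" by (simp add: \<delta>_def)
    have 8: "(1 + \<delta>) * x = x + \<delta> * x" for x by (simp add: algebra_simps)
    have "0 \<le> \<delta> * FG" "0 \<le> ?M * AG" using delta nonneg M0 by auto
    then show ?thesis using 3 4 5 6 7 unfolding 8 by linarith
  qed

  \<comment> \<open>For nonempty \<open>H\<close>, both \<open>card H\<close> and \<open>w\<close>
    are at most L^2 n, whereas \<open>U\<close> is at least n L D^z / (4 * 2^z). Exchanging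
    \<open>g\<close> for \<open>f\<close> on \<open>H\<close> and at \<open>b\<close> is therefore
    cheap compared with \<open>U\<close>.\<close>
  have outer: "\<bar>FH - w * g b powr z\<bar> \<le> \<epsilon> / 4 * A + \<epsilon> / 25 * U"
  proof (cases "H = {}")
    case True
    have "0 \<le> \<epsilon> / 4 * A + \<epsilon> / 25 * U" using nonneg A eps by (auto simp: U_def)
    then show ?thesis using True by (simp add: FH_def w_def AH_def)
  next
    case False
    then obtain j where j: "j \<in> H" by auto
    then have jn: "j < n" using H by auto
    have "f j powr z \<le> f b powr z"
      using furthest f_nonneg jn z by (intro powr_mono2) auto
    then have fb: "A < L\<^sup>2 * (real n * f b powr z)"
      using H(2)[OF j] by (meson less_le_trans mult_left_mono of_nat_0_le_iff zero_le_power2)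
    then have fb0: "0 < f b powr z" using A by (cases "f b powr z = 0") auto
    have "w \<le> A / f b powr z" unfolding w_def using AH_le fb0 by (intro divide_right_mono) auto
    also have "\<dots> \<le> L\<^sup>2 * real n" using fb fb0 by (simp add: field_simps)
    finally have w_le: "w \<le> L\<^sup>2 * real n" .
    \<comment> \<open>Markov's inequality: each point of \<open>H\<close> contributes more than A /
      (L^2 n) to the cost A.\<close>
    have "real (card H) * A \<le> (\<Sum>i\<in>H. L\<^sup>2 * (real n * f i powr z))"
      using sum_mono[of H "\<lambda>_. A"] H(2) by (simp add: less_imp_le)
    also have "\<dots> = L\<^sup>2 * real n * AH" by (simp add: AH_def sum_distrib_left mult_ac)
    also have "\<dots> \<le> L\<^sup>2 * real n * A" using AH_le by (intro mult_left_mono) auto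
    finally have H_le: "real (card H) \<le> L\<^sup>2 * real n" using A by simp

    \<comment> \<open>If every point with n f^z \<le> 2 A is in \<open>G\<close>, these are at least
      half of all points by Markov's inequality. Otherwise \<open>G - {a}\<close> and a refused
      point together cost more than L A, while each of these points costs at most 2 A / n.\<close>
    have G_large: "real n * L / 4 \<le> real (card G)"
    proof (cases "\<forall>i<n. real n * f i powr z \<le> 2 * A \<longrightarrow> i \<in> G")
      case True
      have "(\<Sum>i\<in>{..<n} - G. 2 * A) \<le> (\<Sum>i\<in>{..<n} - G. real n * f i powr z)"
        using True by (intro sum_mono) (auto simp: not_le intro: less_imp_le)
      also have "\<dots> \<le> real n * A"
        unfolding sum_distrib_left[symmetric] by (intro mult_left_mono A_sub) auto
      finally have "2 * real (card ({..<n} - G)) \<le> real n" using A by (simp add: mult_ac)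
      moreover have "real (card ({..<n} - G)) = real n - real (card G)"
        using G card_mono[OF _ G(1)] by (subst card_Diff_subset) (auto simp: fin of_nat_diff)
      ultimately have "real n / 2 \<le> real (card G)" by simp
      moreover have "real n * L \<le> real n * 1" using L1 by (intro mult_left_mono) auto
      ultimately show ?thesis by simp
    next
      case False
      then obtain i where i: "i < n" "real n * f i powr z \<le> 2 * A" "i \<notin> G" by auto
      then have "L * A < AG + f i powr z" using G_full[OF i(1,2)] by (simp add: AG_def)
      then have "real n * (L * A) < real n * (AG + f i powr z)" using n by (intro mult_strict_left_mono)
      also have "\<dots> \<le> real n * AG + 2 * A" using i by (simp add: algebra_simps)
      finally have 1: "real n * (L * A) < real n * AG + 2 * A" .
      have "real n * AG = (\<Sum>i\<in>G - {a}. real n * f i powr z)"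
        by (simp add: AG_def sum_distrib_left)
      also have "\<dots> \<le> N * (2 * A)"
        unfolding N_def by (intro sum_bounded_above G_near)
      finally have "real n * L * A < (2 * N + 2) * A" using 1 by (simp add: algebra_simps)
      then have "real n * L < 2 * real (card G)" using A by (simp add: card_G)
      then show ?thesis using L_pos n by simp
    qed
    \<comment> \<open>Every point of \<open>G\<close> pays for D through its distance to c or to
      y.\<close>
    have "real (card G) * D powr z = (\<Sum>i\<in>G. D powr z)" by simp
    also have "\<dots> \<le> (\<Sum>i\<in>G. 2 powr z * (f i powr z + g i powr z))"
      using powr_D_le G by (intro sum_mono) auto
    also have "\<dots> = 2 powr z * ((\<Sum>i\<in>G. f i powr z) + (\<Sum>i\<in>G. g i powr z))"
      by (simp add: sum.distrib flip: sum_distrib_left)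
    also have "\<dots> \<le> 2 powr z * U"
      using A_sub[OF G(1)] nonneg by (intro mult_left_mono) (auto simp: U_def sum_G[of "\<lambda>i. g i powr z"] FG_def)
    finally have "real (card G) * D powr z \<le> 2 powr z * U" .
    moreover have "real n * L / 4 * D powr z \<le> real (card G) * D powr z"
      using G_large by (intro mult_right_mono) auto
    ultimately have nD: "real n * L * D powr z \<le> 4 * (2 powr z * U)" by simp
    have U0: "0 \<le> U" using nonneg A by (auto simp: U_def)

    have "2 * (M * (L\<^sup>2 * real n * D powr z)) = 2 * M * L * (real n * L * D powr z)"
      by (simp add: power2_eq_square mult_ac)
    also have "\<dots> \<le> 2 * M * L * (4 * (2 powr z * U))"
      using nD M0 L_pos by (intro mult_left_mono) auto
    also have "\<dots> = 4 * (2 * (M * 2 powr z)) * (L * U)" by (simp add: mult_ac)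
    also have "\<dots> \<le> 4 * T * (L * U)" using MT L_pos U0 by (intro mult_right_mono) auto
    also have "\<dots> = 4 * (L * T) * U" by simp
    also have "\<dots> = 4 * (1 / T) * U" unfolding LT1 ..
    also have "\<dots> \<le> 4 * (\<epsilon> / 100) * U" using invT U0 by (intro mult_right_mono mult_left_mono) auto
    finally have small: "2 * (M * (L\<^sup>2 * real n * D powr z)) \<le> \<epsilon> / 25 * U" by simp
    define E where "E = M * (L\<^sup>2 * real n * D powr z)"
    have E0: "0 \<le> E" using M0 by (simp add: E_def)
    have wE: "w * (M * D powr z) \<le> E"
      using mult_right_mono[OF w_le, of "M * D powr z"] M0 by (simp add: E_def mult_ac)
    have HE: "real (card H) * (M * D powr z) \<le> E"
      using mult_right_mono[OF H_le, of "M * D powr z"] M0 by (simp add: E_def mult_ac)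

    have "FH \<le> (\<Sum>i\<in>H. (1 + \<delta>) * f i powr z + M * D powr z)"
      unfolding FH_def using H g_le g_nonneg f_nonneg D_nonneg by (intro sum_mono close) auto
    then have 1: "FH \<le> (1 + \<delta>) * AH + E"
      using HE by (simp only: sum.distrib sum_constant AH_def flip: sum_distrib_left)
    have "AH \<le> (\<Sum>i\<in>H. (1 + \<delta>) * g i powr z + M * D powr z)"
      unfolding AH_def using H f_le g_nonneg f_nonneg D_nonneg by (intro sum_mono close) auto
    then have 2: "AH \<le> (1 + \<delta>) * FH + E"
      using HE by (simp only: sum.distrib sum_constant FH_def flip: sum_distrib_left)
    have wAH: "w * f b powr z = AH" using fb0 by (simp add: w_def)
    have "w * g b powr z \<le> w * ((1 + \<delta>) * f b powr z + M * D powr z)"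
      using abe g_le g_nonneg f_nonneg D_nonneg nonneg by (intro mult_left_mono close) auto
    also have "\<dots> = (1 + \<delta>) * (w * f b powr z) + w * (M * D powr z)" by (simp add: algebra_simps)
    finally have 3: "w * g b powr z \<le> (1 + \<delta>) * AH + E" using wE wAH by simp
    have "w * f b powr z \<le> w * ((1 + \<delta>) * g b powr z + M * D powr z)"
      using abe f_le g_nonneg f_nonneg D_nonneg nonneg by (intro mult_left_mono close) auto
    also have "\<dots> = (1 + \<delta>) * (w * g b powr z) + w * (M * D powr z)" by (simp add: algebra_simps)
    finally have 4: "AH \<le> (1 + \<delta>) * (w * g b powr z) + E" using wE wAH by simp
    \<comment> \<open>This inverts the bounds 2 and 4: \<open>FH\<close> and the weighted cost of
      \<open>b\<close> both lie within \<open>\<delta> * AH + E\<close> of \<open>AH\<close>, hence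
      within twice that of each other.\<close>
    have low: "AH - \<delta> * AH - E \<le> v" if "AH \<le> (1 + \<delta>) * v + E" "0 \<le> v" for v
    proof (cases "v \<le> AH")
      case True
      then have "\<delta> * v \<le> \<delta> * AH" using delta by (intro mult_left_mono) auto
      then show ?thesis using that by (simp add: algebra_simps)
    next
      case False
      moreover have "0 \<le> \<delta> * AH" using delta nonneg by simp
      ultimately show ?thesis using E0 by linarith
    qed
    have "\<delta> * AH \<le> \<delta> * A" using AH_le delta by (intro mult_left_mono) auto
    then have "2 * (\<delta> * AH) \<le> \<epsilon> / 4 * A" by (simp add: \<delta>_def mult.commute)
    moreover have "0 \<le> w * g b powr z" using nonneg by simp
    moreover have "(1 + \<delta>) * AH = AH + \<delta> * AH" by (simp add: algebra_simps)
    ultimately show ?thesis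
      using 1 3 low[OF 2 nonneg(2)] low[OF 4] small unfolding E_def[symmetric] by linarith
  qed

  \<comment> \<open>Because \<open>a\<close> lies in Z, D^z is at most 2^z \<open>U\<close>. Hence
    every single point costs at most 2 * 4^z \<open>U\<close>, and 4^z is at most
    \<open>T\<close>.\<close>
  have filler: "L * g i powr z \<le> \<epsilon> / 50 * U" if "i < n" for i
  proof -
    have AU: "A \<le> U" using nonneg by (simp add: U_def)
    have "D powr z \<le> 2 powr z * (f a powr z + g a powr z)" using powr_D_le abe by simp
    also have "\<dots> \<le> 2 powr z * U"
      using powr_f_le_A[OF abe(1)] nonneg by (intro mult_left_mono) (auto simp: U_def)
    finally have "f i powr z + D powr z \<le> 1 * U + 2 powr z * U"
      using powr_f_le_A[OF that] AU by simp
    also have "\<dots> \<le> 2 powr z * U + 2 powr z * U"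
      using p2 nonneg A by (intro add_right_mono mult_right_mono) (auto simp: U_def)
    finally have *: "f i powr z + D powr z \<le> 2 * (2 powr z * U)" by linarith
    have "g i powr z \<le> 2 powr z * (f i powr z + D powr z)" using powr_g_le that by simp
    also have "\<dots> \<le> 2 powr z * (2 * (2 powr z * U))" using * by (intro mult_left_mono) auto
    also have "\<dots> = (2 powr z * 2 powr z) * (2 * U)" by simp
    also have "\<dots> \<le> T * (2 * U)" using T4 nonneg A by (intro mult_right_mono) (auto simp: U_def)
    finally have "L * g i powr z \<le> L * (T * (2 * U))" using L_pos by (intro mult_left_mono) auto
    also have "\<dots> = 2 * (L * T) * U" by simp
    also have "\<dots> = 2 * (1 / T) * U" unfolding LT1 ..
    also have "\<dots> \<le> 2 * (\<epsilon> / 100) * U"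
      using invT nonneg A by (intro mult_right_mono mult_left_mono) (auto simp: U_def)
    finally show ?thesis by simp
  qed

  define V where "V = \<epsilon> * U"
  have V: "\<epsilon> * FG \<le> V" "\<epsilon> * A \<le> V" "0 \<le> V"
    using nonneg A eps by (auto intro!: mult_left_mono simp: U_def V_def)
  have "\<epsilon> / 4 * FG = \<epsilon> * FG / 4" "\<epsilon> / 50 * A = \<epsilon> * A / 50" "\<epsilon> / 4 * A = \<epsilon> * A / 4"
    "\<epsilon> / 25 * U = V / 25"
    by (simp_all add: V_def)
  then have "\<bar>FG - N * g a powr z\<bar> \<le> V / 4 + V / 50" "\<bar>FH - w * g b powr z\<bar> \<le> V / 4 + V / 25"
    using inner outer V(1,2) by linarith+
  moreover have "L * g i powr z \<le> V / 50" "0 \<le> L * g i powr z" if "i < n" for i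
    using filler[OF that] L_pos by (simp_all add: V_def)
  note this[OF abe(1)] this[OF abe(2)] this[OF abe(3)]
  \<comment> \<open>The fractions 1/4 + 1/50, 1/4 + 1/25 and 3/50 add up to less than 1.\<close>
  ultimately have "\<bar>(FG - N * g a powr z) + (FH - w * g b powr z)
      - (L * g a powr z + L * g b powr z + L * g e powr z)\<bar> \<le> V"
    using V(3) by linarith
  moreover have "(\<Sum>i\<in>G \<union> H. g i powr z) + A = U" by (simp add: sum_GH U_def)
  moreover have "(\<Sum>i\<in>G \<union> H. g i powr z) - ((real (card G) + L) * g a powr z
      + ((\<Sum>i\<in>H. f i powr z) / f b powr z + L) * g b powr z + L * g e powr z)
    = (FG - N * g a powr z) + (FH - w * g b powr z)
      - (L * g a powr z + L * g b powr z + L * g e powr z)"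
    by (simp add: sum_GH card_G w_def AH_def algebra_simps)
  ultimately show ?thesis
    by (simp only: V_def)
qed

end

section \<open>Executing programs\<close>

text \<open>Meaningful for loop-free programs only; the equation for \<open>While\<close> is a
  default value. The same holds for \<open>ctime\<close>, which bounds the time independently of the
  state by counting both branches of a conditional.\<close>

primrec run :: "queries \<Rightarrow> com \<Rightarrow> state \<Rightarrow> state" where
  "run \<delta> Skip s = s"
| "run \<delta> (NPut A i e) s = nput A (nval i s) (nval e s) s"
| "run \<delta> (RPut A i e) s = rput A (nval i s) (rval \<delta> e s) s"
| "run \<delta> (Seq p q) s = run \<delta> q (run \<delta> p s)"
| "run \<delta> (Cond b p q) s = (if bval \<delta> b s then run \<delta> p s else run \<delta> q s)"
| "run \<delta> (While b p) s = s"

primrec loop_free :: "com \<Rightarrow> bool" where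
  "loop_free Skip \<longleftrightarrow> True"
| "loop_free (NPut A i e) \<longleftrightarrow> True"
| "loop_free (RPut A i e) \<longleftrightarrow> True"
| "loop_free (Seq p q) \<longleftrightarrow> loop_free p \<and> loop_free q"
| "loop_free (Cond b p q) \<longleftrightarrow> loop_free p \<and> loop_free q"
| "loop_free (While b p) \<longleftrightarrow> False"

primrec ctime :: "com \<Rightarrow> nat" where
  "ctime Skip = 1"
| "ctime (NPut A i e) = ntime i + ntime e + 1"
| "ctime (RPut A i e) = ntime i + rtime e + 1"
| "ctime (Seq p q) = ctime p + ctime q"
| "ctime (Cond b p q) = btime b + ctime p + ctime q + 1"
| "ctime (While b p) = 0"

text \<open>A bound in place of the exact time lets branches of different length share one
  estimate.\<close>

definition runs :: "queries \<Rightarrow> com \<Rightarrow> state \<Rightarrow> nat \<Rightarrow> state \<Rightarrow> bool" where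
  "runs \<delta> p s T s' \<longleftrightarrow> (\<exists>t\<le>T. exec \<delta> p s t s')"

lemma runs_loop_free: "loop_free p \<Longrightarrow> runs \<delta> p s (ctime p) (run \<delta> p s)"
proof (induction p arbitrary: s)
  case (Seq p q)
  then obtain t t' where "t \<le> ctime p" "exec \<delta> p s t (run \<delta> p s)"
    "t' \<le> ctime q" "exec \<delta> q (run \<delta> p s) t' (run \<delta> q (run \<delta> p s))"
    by (metis loop_free.simps(4) runs_def)
  then show ?case
    unfolding runs_def by (intro exI[of _ "t + t'"]) (auto intro: exec.Seq)
next
  case (Cond b p q)
  show ?case
  proof (cases "bval \<delta> b s")
    case True
    with Cond obtain t where "t \<le> ctime p" "exec \<delta> p s t (run \<delta> p s)"
      by (metis loop_free.simps(5) runs_def)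
    with True show ?thesis
      unfolding runs_def by (intro exI[of _ "btime b + t + 1"]) (auto intro: exec.CondTrue[simplified])
  next
    case False
    with Cond obtain t where "t \<le> ctime q" "exec \<delta> q s t (run \<delta> q s)"
      by (metis loop_free.simps(5) runs_def)
    with False show ?thesis
      unfolding runs_def by (intro exI[of _ "btime b + t + 1"]) (auto intro: exec.CondFalse[simplified])
  qed
qed (auto simp: runs_def intro: exec.Skip[simplified] exec.NPut[simplified] exec.RPut[simplified])

lemma runs_Seq: "runs \<delta> p s T s' \<Longrightarrow> runs \<delta> q s' T' s'' \<Longrightarrow> runs \<delta> (Seq p q) s (T + T') s''"
  unfolding runs_def by (meson add_mono exec.Seq)

lemma runs_Cond:
  assumes "runs \<delta> (if bval \<delta> b s then p else q) s T s'"
  shows "runs \<delta> (Cond b p q) s (btime b + T + 1) s'"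
proof -
  obtain t where t: "t \<le> T" "exec \<delta> (if bval \<delta> b s then p else q) s t s'"
    using assms unfolding runs_def by blast
  then have "exec \<delta> (Cond b p q) s (btime b + t + 1) s'"
    by (cases "bval \<delta> b s") (auto intro: exec.CondTrue[simplified] exec.CondFalse[simplified])
  with t show ?thesis unfolding runs_def by (meson add_mono order_refl)
qed

lemma runs_mono: "runs \<delta> p s T s' \<Longrightarrow> T \<le> T' \<Longrightarrow> runs \<delta> p s T' s'"
  unfolding runs_def by (meson order_trans)

section \<open>State access and counting loops\<close>

lemma nats_nput [simp]: "nats (nput A i v s) = (nats s)(A := (nats s A)(i := v))"
  and reals_nput [simp]: "reals (nput A i v s) = reals s"
  and nats_rput [simp]: "nats (rput A i r s) = nats s"
  and reals_rput [simp]: "reals (rput A i r s) = (reals s)(A := (reals s A)(i := r))"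
  by (simp_all add: nput_def rput_def)

abbreviation nvar :: "nat \<Rightarrow> nexp" where "nvar j \<equiv> NGet 0 (NConst j)"
abbreviation rvar :: "nat \<Rightarrow> rexp" where "rvar j \<equiv> RGet 0 (NConst j)"
abbreviation nset :: "nat \<Rightarrow> nexp \<Rightarrow> com" where "nset j e \<equiv> NPut 0 (NConst j) e"
abbreviation rset :: "nat \<Rightarrow> rexp \<Rightarrow> com" where "rset j e \<equiv> RPut 0 (NConst j) e"
abbreviation rconst :: "nat \<Rightarrow> rexp" where "rconst m \<equiv> RNat (NConst m)"

definition for_loop :: "com \<Rightarrow> com" where
  "for_loop body = Seq (nset 2 (NConst 0))
     (While (NLess (nvar 2) (nvar 0)) (Seq body (nset 2 (NAdd (nvar 2) (NConst 1)))))"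

text \<open>\<open>J i\<close> describes the state after \<open>i\<close> rounds. It has to fix the
  counter and the bound, which a body could otherwise overwrite. Test and increment fit into 20
  steps per round, and the surplus round in \<open>n + 1\<close> pays for the initialization and the
  last test.\<close>

lemma runs_for_loop:
  assumes lf: "loop_free body"
    and J: "\<And>i s. J i s \<Longrightarrow> nats s 0 2 = i \<and> nats s 0 0 = n"
    and step: "\<And>i s. i < n \<Longrightarrow> J i s \<Longrightarrow> J (Suc i) (run \<delta> (Seq body (nset 2 (NAdd (nvar 2) (NConst 1)))) s)"
    and init: "J 0 (nput 0 2 0 s)"
  obtains s' where "runs \<delta> (for_loop body) s ((n + 1) * (ctime body + 20)) s'" "J n s'"
proof -
  define inc where "inc = Seq body (nset 2 (NAdd (nvar 2) (NConst 1)))"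
  define wh where "wh = While (NLess (nvar 2) (nvar 0)) inc"
  have "\<exists>s'. runs \<delta> wh s (m * (ctime body + 20) + 6) s' \<and> J n s'"
    if "J i s" "i + m = n" for i m s
    using that
  proof (induction m arbitrary: i s)
    case 0
    then have "\<not> bval \<delta> (NLess (nvar 2) (nvar 0)) s" using J by fastforce
    then have "exec \<delta> wh s (btime (NLess (nvar 2) (nvar 0)) + 1) s"
      unfolding wh_def by (rule exec.WhileFalse)
    with 0 show ?case
      unfolding runs_def by (intro exI[of _ s] conjI exI[of _ 6]) (auto simp: eval_nat_numeral)
  next
    case (Suc m)
    then have b: "bval \<delta> (NLess (nvar 2) (nvar 0)) s" using J by fastforce
    have "loop_free inc" using lf by (simp add: inc_def)
    from runs_loop_free[OF this] obtain t where t: "t \<le> ctime inc" "exec \<delta> inc s t (run \<delta> inc s)"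
      unfolding runs_def by blast
    have "J (Suc i) (run \<delta> inc s)" using step[of i s] Suc.prems unfolding inc_def by simp
    from Suc.IH[OF this] Suc.prems obtain t' s' where
      t': "t' \<le> m * (ctime body + 20) + 6" "exec \<delta> wh (run \<delta> inc s) t' s'" "J n s'"
      unfolding runs_def by auto
    have "exec \<delta> wh s (btime (NLess (nvar 2) (nvar 0)) + t + t' + 1) s'"
      unfolding wh_def by (rule exec.WhileTrue[OF b t(2) t'(2)[unfolded wh_def]])
    with t t' show ?case unfolding runs_def inc_def
      by (intro exI[of _ s'] conjI exI) (auto simp: algebra_simps)
  qed
  from this[of 0 "nput 0 2 0 s" n] init obtain s' where
    s': "runs \<delta> wh (nput 0 2 0 s) (n * (ctime body + 20) + 6) s'" "J n s'" by auto
  have "runs \<delta> (nset 2 (NConst 0)) s 3 (nput 0 2 0 s)"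
    using runs_loop_free[of "nset 2 (NConst 0)" \<delta> s] by (simp add: numeral_3_eq_3)
  from runs_Seq[OF this s'(1)] have "runs \<delta> (for_loop body) s (3 + (n * (ctime body + 20) + 6)) s'"
    unfolding for_loop_def wh_def inc_def .
  then show ?thesis
    by (intro that[OF _ s'(2)]) (erule runs_mono, simp)
qed

section \<open>Invariants of the two passes over the points\<close>

text \<open>The furthest point is updated on ties and the nearest one is not, so the two differ.\<close>

definition extremes :: "(nat \<Rightarrow> real) \<Rightarrow> nat \<Rightarrow> nat \<Rightarrow> nat \<Rightarrow> bool" where
  "extremes f i a b \<longleftrightarrow> (if i = 0 then a = 0 \<and> b = 0
     else a < i \<and> b < i \<and> (\<forall>j<i. f a \<le> f j \<and> f j \<le> f b)) \<and> (2 \<le> i \<longrightarrow> a \<noteq> b)"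

lemma extremes_Suc:
  assumes "extremes f i a b"
  shows "extremes f (Suc i) (if f i < f a then i else a) (if \<not> f i < f b then i else b)"
proof (cases "i = 0")
  case False
  with assms have *: "a < i" "b < i" "f a \<le> f j" "f j \<le> f b" if "j < i" for j
    using that by (auto simp: extremes_def)
  from False have ab: "a < i" "b < i" "f a \<le> f b" using *[of 0] by auto
  have "f (if f i < f a then i else a) \<le> f j \<and> f j \<le> f (if \<not> f i < f b then i else b)"
    if "j < Suc i" for j
    using *[of j] that by (cases "j = i") (auto simp: less_Suc_eq)
  moreover have "(if f i < f a then i else a) \<noteq> (if \<not> f i < f b then i else b)"
  \<comment> \<open>At the second point both indices are still 0 and exactly one of the two tests
    succeeds. Later on, \<open>f a \<le> f b\<close> prevents both from succeeding.\<close>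
  proof (cases "i = 1")
    case True
    then show ?thesis using ab by auto
  next
    case 2: False
    then have "a \<noteq> b" using assms False by (auto simp: extremes_def)
    then show ?thesis using ab by auto
  qed
  ultimately show ?thesis using ab unfolding extremes_def by auto
qed (use assms in \<open>simp add: extremes_def\<close>)

text \<open>The invariant after \<open>i\<close> points, with \<open>h\<close> for f^z. The last
  clause grants L A to the greedy choices and a share L A / n to each point seen, meant for the
  points with n h \<le> L A; at \<open>i = n\<close> this is 2 L A. A refusal is stated for the
  current \<open>G\<close> and persists, because the sum over \<open>G - {a}\<close> only
  grows.\<close>

definition classified ::
  "(nat \<Rightarrow> real) \<Rightarrow> nat \<Rightarrow> real \<Rightarrow> real \<Rightarrow> nat \<Rightarrow> nat \<Rightarrow> nat set \<Rightarrow> nat set \<Rightarrow> bool" where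
  "classified h n A L a i G H \<longleftrightarrow>
     G \<subseteq> {..<i} \<and> H \<subseteq> {..<i} \<and> G \<inter> H = {} \<and> (a < i \<longrightarrow> a \<in> G) \<and>
     (\<forall>j\<in>H. A < L * L * (real n * h j)) \<and>
     (\<forall>j\<in>G - {a}. real n * h j \<le> 2 * A) \<and>
     (\<forall>j<i. j \<notin> G \<union> H \<longrightarrow> L * A < real n * h j \<and> L * L * (real n * h j) \<le> A \<and>
        (real n * h j \<le> 2 * A \<longrightarrow> L * A < (\<Sum>j\<in>G - {a}. h j) + h j)) \<and>
     (\<Sum>j\<in>G - {a}. h j) \<le> L * A + real i * (L * A) / real n"

lemma classified_0: "0 \<le> A \<Longrightarrow> 0 \<le> L \<Longrightarrow> classified h n A L a 0 {} {}"
  by (simp add: classified_def)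

lemma classified_finite:
  "classified h n A L a i G H \<Longrightarrow> finite G \<and> finite H \<and> i \<notin> G \<and> i \<notin> H"
  by (auto simp: classified_def intro: finite_subset)

lemma classified_cost_mono:
  fixes A L :: real
  assumes "0 \<le> A" "0 \<le> L" "x \<le> L * A + real i * (L * A) / real n"
  shows "x \<le> L * A + real (Suc i) * (L * A) / real n"
proof -
  have "real i * (L * A) / real n \<le> real (Suc i) * (L * A) / real n"
    using assms by (intro divide_right_mono mult_right_mono) auto
  with assms show ?thesis by linarith
qed

lemma classified_center:
  assumes "classified h n A L a i G H" "i = a" "0 \<le> A" "0 \<le> L"
  shows "classified h n A L a (Suc i) (insert i G) H"
proof -
  have "insert i G - {a} = G - {a}" using assms by auto
  then show ?thesis using assms
    unfolding classified_def
    by (auto simp: less_Suc_eq simp del: of_nat_Suc intro!: classified_cost_mono)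
qed

lemma classified_far:
  assumes "classified h n A L a i G H" "i \<noteq> a" "A < L * L * (real n * h i)" "0 \<le> A" "0 \<le> L"
  shows "classified h n A L a (Suc i) G (insert i H)"
  using assms classified_finite[OF assms(1)] unfolding classified_def
  by (auto simp: less_Suc_eq simp del: of_nat_Suc intro!: classified_cost_mono)

text \<open>A point with n h \<le> L A is paid by its own share; any other one is added only while
  the whole sum stays within L A.\<close>

lemma classified_near:
  assumes cl: "classified h n A L a i G H" and "i \<noteq> a" and near: "real n * h i \<le> 2 * A"
    and add: "real n * h i \<le> L * A \<or> (\<Sum>j\<in>G - {a}. h j) + h i \<le> L * A"
    and nonneg: "0 \<le> A" "0 \<le> L" "0 < n" "0 \<le> h i"
  shows "classified h n A L a (Suc i) (insert i G) H"
proof -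
  have fin: "finite G" "i \<notin> G" "i \<notin> H" using classified_finite[OF cl] by auto
  have eq: "insert i G - {a} = insert i (G - {a})" using \<open>i \<noteq> a\<close> by auto
  have s: "(\<Sum>j\<in>insert i G - {a}. h j) = (\<Sum>j\<in>G - {a}. h j) + h i"
    using fin unfolding eq by (simp add: sum.insert)
  have "(\<Sum>j\<in>G - {a}. h j) + h i \<le> L * A + real (Suc i) * (L * A) / real n"
    using add
  proof
    assume "real n * h i \<le> L * A"
    then have "h i \<le> L * A / real n" using nonneg by (simp add: field_simps)
    moreover have "(\<Sum>j\<in>G - {a}. h j) \<le> L * A + real i * (L * A) / real n"
      using cl by (simp add: classified_def)
    moreover have "real (Suc i) * (L * A) / real n = real i * (L * A) / real n + L * A / real n"
      by (simp add: add_divide_distrib algebra_simps)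
    ultimately show ?thesis by linarith
  next
    assume "(\<Sum>j\<in>G - {a}. h j) + h i \<le> L * A"
    moreover have "0 \<le> real (Suc i) * (L * A) / real n" using nonneg by simp
    ultimately show ?thesis by linarith
  qed
  then show ?thesis
    using cl fin near nonneg unfolding classified_def s
    by (auto simp: less_Suc_eq intro: order_less_le_trans)
qed

lemma classified_skip:
  assumes "classified h n A L a i G H" "i \<noteq> a" "L * L * (real n * h i) \<le> A" "L * A < real n * h i"
    "real n * h i \<le> 2 * A \<longrightarrow> L * A < (\<Sum>j\<in>G - {a}. h j) + h i" "0 \<le> A" "0 \<le> L"
  shows "classified h n A L a (Suc i) G H"
  using assms unfolding classified_def
  by (auto simp: less_Suc_eq simp del: of_nat_Suc intro!: classified_cost_mono)

section \<open>The algorithm\<close>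

text \<open>
  Array 0 of the natural numbers holds \<open>n\<close>, \<open>k\<close>, the loop counter, \<open>a\<close>, \<open>b\<close> and the third point;
  array 0 of the reals holds \<open>z\<close>, \<open>\<epsilon>\<close>, \<open>A\<close>, \<open>L\<close>, the costs of \<open>G - {a}\<close> and \<open>H\<close>, and \<open>|G|\<close>.
\<close>

abbreviation center_dist :: "nexp \<Rightarrow> rexp" where "center_dist e \<equiv> RDist e (nvar 0)"
abbreviation center_cost :: "nexp \<Rightarrow> rexp" where "center_cost e \<equiv> RPow (center_dist e) (rvar 0)"
abbreviation label_current :: com where "label_current \<equiv> NPut 1 (nvar 2) (NConst 1)"
abbreviation neq :: "nexp \<Rightarrow> nexp \<Rightarrow> bexp" where
  "neq x y \<equiv> BNot (BAnd (BNot (NLess x y)) (BNot (NLess y x)))"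

definition tiny_prog :: com where
  "tiny_prog = for_loop (Seq label_current (RPut 1 (nvar 2) (rconst 1)))"

text \<open>Cell 0 of the naturals holds \<open>n\<close>, which doubles as the handle of c in every
  distance query.\<close>

definition extremes_prog :: com where
  "extremes_prog = for_loop
     (Seq (Cond (RLess (center_dist (nvar 2)) (center_dist (nvar 3))) (nset 3 (nvar 2)) Skip)
     (Seq (Cond (BNot (RLess (center_dist (nvar 2)) (center_dist (nvar 4)))) (nset 4 (nvar 2)) Skip)
       (rset 2 (RAdd (rvar 2) (center_cost (nvar 2))))))"

text \<open>Only two handles are excluded, so one of 0, 1, 2 is free; the last free one is
  kept.\<close>

definition third_prog :: com where
  "third_prog =
     (let try = (\<lambda>j. Cond (BAnd (neq (NConst j) (nvar 3)) (neq (NConst j) (nvar 4)))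
        (nset 5 (NConst j)) Skip)
      in Seq (try 0) (Seq (try 1) (try 2)))"

definition weights_prog :: "rexp \<Rightarrow> rexp \<Rightarrow> rexp \<Rightarrow> com" where
  "weights_prog u v w = Seq (RPut 1 (nvar 3) u) (Seq (RPut 1 (nvar 4) v) (RPut 1 (nvar 5) w))"

definition crude_prog :: com where
  "crude_prog = Seq (for_loop label_current)
     (weights_prog (RDiv (RNat (nvar 0)) (rconst 10)) (RDiv (rconst 1) (rconst 100))
       (RDiv (rconst 1) (rconst 100)))"

text \<open>A point with n h \<le> 2 A is refused only if n h > L A and it exceeds the remaining
  budget. The initial label 0 already means W, so \<open>Skip\<close> suffices for all remaining
  points.\<close>

definition classify_body :: com where
  "classify_body =
     (let h = center_cost (nvar 2); nh = RMul (RNat (nvar 0)) h; LA = RMul (rvar 3) (rvar 2);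
        count = rset 6 (RAdd (rvar 6) (rconst 1))
      in Cond (BNot (neq (nvar 2) (nvar 3))) (Seq label_current count)
       (Cond (RLess (rvar 2) (RMul (RMul (rvar 3) (rvar 3)) nh))
         (Seq label_current (rset 5 (RAdd (rvar 5) h)))
       (Cond (BAnd (BNot (RLess (RMul (rconst 2) (rvar 2)) nh))
           (BNot (BAnd (RLess LA nh) (RLess LA (RAdd (rvar 4) h)))))
         (Seq label_current (Seq count (rset 4 (RAdd (rvar 4) h))))
         Skip)))"

text \<open>The first assignment stores L. Its negative exponent is formed as a difference,
  constants being natural numbers.\<close>

definition fine_prog :: com where
  "fine_prog = Seq (rset 3 (RPow (RDiv (RMul (rconst 100) (rvar 0)) (rvar 1))
       (RMul (RSub (rconst 0) (rconst 2)) (rvar 0))))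
     (Seq (for_loop classify_body)
       (weights_prog (RAdd (rvar 6) (rvar 3))
         (RAdd (RDiv (rvar 5) (center_cost (nvar 4))) (rvar 3)) (rvar 3)))"

definition coreset_prog :: com where
  "coreset_prog = Cond (NLess (nvar 0) (NConst 4)) tiny_prog
     (Seq extremes_prog (Seq third_prog
       (Cond (RLess (rvar 0) (RMul (RDiv (rconst 101) (rconst 100)) (rvar 1))) crude_prog fine_prog)))"

section \<open>Runs of the parts of the program\<close>

lemma runs_tiny_prog:
  assumes "nats s 0 0 = n"
  obtains s' where "runs \<delta> tiny_prog s ((n + 1) * 100) s'"
    "\<forall>i<n. nats s' 1 i = 1 \<and> reals s' 1 i = 1"
proof -
  define J :: "nat \<Rightarrow> state \<Rightarrow> bool" where "J = (\<lambda>i s. nats s 0 2 = i \<and> nats s 0 0 = n \<and> (\<forall>j<i. nats s 1 j = 1 \<and> reals s 1 j = 1))"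
  obtain s' where s': "runs \<delta> tiny_prog s ((n + 1) *
      (ctime (Seq label_current (RPut 1 (nvar 2) (rconst 1))) + 20)) s'" "J n s'"
    unfolding tiny_prog_def
  proof (rule runs_for_loop[where J = J])
    show "J (Suc i) (run \<delta> (Seq (Seq label_current (RPut 1 (nvar 2) (rconst 1))) (nset 2 (NAdd (nvar 2) (NConst 1)))) s)"
      if "i < n" "J i s" for i s
      using that by (auto simp: J_def less_Suc_eq)
  qed (use assms in \<open>auto simp: J_def\<close>)
  show ?thesis
    using s' by (intro that) (auto simp: J_def elim!: runs_mono)
qed

lemma runs_extremes_prog:
  assumes "nats s 0 0 = n" "reals s 0 0 = z" "nats s 0 3 = 0" "nats s 0 4 = 0" "reals s 0 2 = 0"
  obtains s' a b where "runs \<delta> extremes_prog s ((n + 1) * 100) s'"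
    "nats s' 0 0 = n" "nats s' 0 3 = a" "nats s' 0 4 = b" "extremes (\<lambda>i. \<delta> i n) n a b"
    "nats s' 1 = nats s 1" "reals s' 1 = reals s 1"
    "reals s' 0 = (reals s 0)(2 := \<Sum>i<n. \<delta> i n powr z)"
proof -
  define J :: "nat \<Rightarrow> state \<Rightarrow> bool" where "J = (\<lambda>i s'. nats s' 0 2 = i \<and> nats s' 0 0 = n \<and>
    extremes (\<lambda>i. \<delta> i n) i (nats s' 0 3) (nats s' 0 4) \<and>
    nats s' 1 = nats s 1 \<and> reals s' 1 = reals s 1 \<and>
    reals s' 0 = (reals s 0)(2 := \<Sum>i<i. \<delta> i n powr z))"
  let ?body = "Seq (Cond (RLess (center_dist (nvar 2)) (center_dist (nvar 3))) (nset 3 (nvar 2)) Skip)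
     (Seq (Cond (BNot (RLess (center_dist (nvar 2)) (center_dist (nvar 4)))) (nset 4 (nvar 2)) Skip)
       (rset 2 (RAdd (rvar 2) (center_cost (nvar 2)))))"
  obtain s' where s': "runs \<delta> extremes_prog s ((n + 1) * (ctime ?body + 20)) s'" "J n s'"
    unfolding extremes_prog_def
  proof (rule runs_for_loop[where J = J])
    show "J (Suc i) (run \<delta> (Seq ?body (nset 2 (NAdd (nvar 2) (NConst 1)))) s)"
      if "i < n" "J i s" for i s
      using that extremes_Suc[of "\<lambda>i. \<delta> i n" i "nats s 0 3" "nats s 0 4"] assms
      by (auto simp: J_def split: if_splits)
  qed (use assms in \<open>auto simp: J_def extremes_def\<close>)
  show ?thesis
    using s' by (intro that[of s']) (auto simp: J_def elim!: runs_mono)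
qed

lemma runs_third_prog:
  assumes "nats s 0 3 = a" "nats s 0 4 = b" "a \<noteq> b"
  obtains s' e where "runs \<delta> third_prog s 100 s'" "e < 3" "e \<noteq> a" "e \<noteq> b"
    "nats s' 0 = (nats s 0)(5 := e)" "nats s' 1 = nats s 1" "reals s' = reals s"
proof -
  have "runs \<delta> third_prog s 100 (run \<delta> third_prog s)"
    by (rule runs_mono[OF runs_loop_free]) (simp_all add: third_prog_def Let_def)
  moreover obtain e where "e < 3" "e \<noteq> a" "e \<noteq> b" "nats (run \<delta> third_prog s) 0 = (nats s 0)(5 := e)"
  proof -
    let ?e = "if 2 \<noteq> a \<and> 2 \<noteq> b then 2 else if 1 \<noteq> a \<and> 1 \<noteq> b then 1 else 0 :: nat"
    have "?e < 3" "?e \<noteq> a" "?e \<noteq> b" using assms(3) by auto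
    moreover have "nats (run \<delta> third_prog s) 0 = (nats s 0)(5 := ?e)"
      using assms by (auto simp: third_prog_def Let_def)
    ultimately show ?thesis by (rule that)
  qed
  moreover have "nats (run \<delta> third_prog s) 1 = nats s 1" "reals (run \<delta> third_prog s) = reals s"
    by (auto simp: third_prog_def Let_def)
  ultimately show ?thesis by (intro that)
qed

text \<open>The weights are written one after the other; the last two hypotheses ensure that the
  later expressions do not depend on the earlier writes.\<close>

lemma runs_weights_prog:
  assumes "nats s 0 3 = a" "nats s 0 4 = b" "nats s 0 5 = e" "reals s 1 = (\<lambda>_. 0)"
    and "\<And>i v. rval \<delta> v' (rput 1 i v s) = rval \<delta> v' s"
    and "\<And>i j v w. rval \<delta> w' (rput 1 j w (rput 1 i v s)) = rval \<delta> w' s"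
  shows "\<exists>s'. runs \<delta> (weights_prog u v' w') s (ctime (weights_prog u v' w')) s' \<and> nats s' = nats s \<and>
    reals s' 1 = (\<lambda>_. 0)(a := rval \<delta> u s, b := rval \<delta> v' s, e := rval \<delta> w' s)"
  using assms by (intro exI[of _ "run \<delta> (weights_prog u v' w') s"] conjI runs_loop_free)
    (auto simp: weights_prog_def)

lemma runs_crude_prog:
  assumes "nats s 0 0 = n" "nats s 0 3 = a" "nats s 0 4 = b" "nats s 0 5 = e" "reals s 1 = (\<lambda>_. 0)"
  obtains s' where "runs \<delta> crude_prog s ((n + 1) * 100 + 100) s'" "\<forall>i<n. nats s' 1 i = 1"
    "reals s' 1 = (\<lambda>_. 0)(a := real n / 10, b := 1 / 100, e := 1 / 100)"
proof -
  define J :: "nat \<Rightarrow> state \<Rightarrow> bool" where "J = (\<lambda>i s'. nats s' 0 0 = n \<and> nats s' 0 2 = i \<and> nats s' 0 3 = a \<and> nats s' 0 4 = b \<and>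
    nats s' 0 5 = e \<and> (\<forall>j<i. nats s' 1 j = 1) \<and> reals s' = reals s)"
  obtain s1 where s1: "runs \<delta> (for_loop label_current) s ((n + 1) * (ctime label_current + 20)) s1" "J n s1"
  proof (rule runs_for_loop[where J = J])
    show "J (Suc i) (run \<delta> (Seq label_current (nset 2 (NAdd (nvar 2) (NConst 1)))) s)"
      if "i < n" "J i s" for i s
      using that by (auto simp: J_def less_Suc_eq)
  qed (use assms in \<open>auto simp: J_def\<close>)
  let ?w = "weights_prog (RDiv (RNat (nvar 0)) (rconst 10)) (RDiv (rconst 1) (rconst 100))
       (RDiv (rconst 1) (rconst 100))"
  obtain s' where s': "runs \<delta> ?w s1 (ctime ?w) s'" "nats s' = nats s1"
    "reals s' 1 = (\<lambda>_. 0)(a := real n / 10, b := 1 / 100, e := 1 / 100)"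
    using runs_weights_prog[of s1 a b e \<delta> "RDiv (rconst 1) (rconst 100)" "RDiv (rconst 1) (rconst 100)"
      "RDiv (RNat (nvar 0)) (rconst 10)"] s1(2) assms by (auto simp: J_def)
  show ?thesis
    using runs_Seq[OF s1(1) s'(1)] s' s1(2)
    by (intro that[of s']) (auto simp: J_def crude_prog_def weights_prog_def elim!: runs_mono)
qed

lemma run_classify_body:
  fixes s :: state and \<delta> :: queries
  defines "i \<equiv> nats s 0 2" and "n \<equiv> nats s 0 0" and "A \<equiv> reals s 0 2" and "L \<equiv> reals s 0 3"
  defines "h \<equiv> \<delta> i n powr reals s 0 0"
  shows "i = nats s 0 3 \<Longrightarrow>
      run \<delta> classify_body s = rput 0 6 (reals s 0 6 + 1) (nput 1 i 1 s)"
    and "i \<noteq> nats s 0 3 \<Longrightarrow> A < L * L * (real n * h) \<Longrightarrow>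
      run \<delta> classify_body s = rput 0 5 (reals s 0 5 + h) (nput 1 i 1 s)"
    and "i \<noteq> nats s 0 3 \<Longrightarrow> \<not> A < L * L * (real n * h) \<Longrightarrow>
      real n * h \<le> 2 * A \<and> \<not> (L * A < real n * h \<and> L * A < reals s 0 4 + h) \<Longrightarrow>
      run \<delta> classify_body s = rput 0 4 (reals s 0 4 + h) (rput 0 6 (reals s 0 6 + 1) (nput 1 i 1 s))"
    and "i \<noteq> nats s 0 3 \<Longrightarrow> \<not> A < L * L * (real n * h) \<Longrightarrow>
      \<not> (real n * h \<le> 2 * A \<and> \<not> (L * A < real n * h \<and> L * A < reals s 0 4 + h)) \<Longrightarrow>
      run \<delta> classify_body s = s"
  by (auto simp: classify_body_def Let_def assms)

lemma runs_classify_prog: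
  assumes s: "nats s 0 0 = n" "nats s 0 3 = a" "reals s 0 0 = z" "reals s 0 2 = A" "reals s 0 3 = L"
    "reals s 0 4 = 0" "reals s 0 5 = 0" "reals s 0 6 = 0" "nats s 1 = (\<lambda>_. 0)"
    and nonneg: "0 \<le> A" "0 \<le> L" "L \<le> 1"
  obtains s' G H where "runs \<delta> (for_loop classify_body) s ((n + 1) * 200) s'"
    "classified (\<lambda>i. \<delta> i n powr z) n A L a n G H"
    "nats s' 1 = (\<lambda>i. if i \<in> G \<union> H then 1 else 0)"
    "nats s' 0 = (nats s 0)(2 := n)" "reals s' 1 = reals s 1" "reals s' 0 0 = z" "reals s' 0 3 = L"
    "reals s' 0 5 = (\<Sum>i\<in>H. \<delta> i n powr z)" "reals s' 0 6 = real (card G)"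
proof -
  define h where "h = (\<lambda>i. \<delta> i n powr z)"
  \<comment> \<open>The sets \<open>G\<close> and \<open>H\<close> are ghost data: the memory holds
    only the labels of their union, the costs of \<open>G - {a}\<close> and \<open>H\<close>, and
    the size of \<open>G\<close>.\<close>
  define J :: "nat \<Rightarrow> state \<Rightarrow> bool" where "J = (\<lambda>i s'. \<exists>G H. nats s' 0 = (nats s 0)(2 := i) \<and> reals s' 1 = reals s 1 \<and>
    reals s' 0 0 = z \<and> reals s' 0 2 = A \<and> reals s' 0 3 = L \<and>
    reals s' 0 4 = (\<Sum>j\<in>G - {a}. h j) \<and> reals s' 0 5 = (\<Sum>j\<in>H. h j) \<and> reals s' 0 6 = real (card G) \<and>
    nats s' 1 = (\<lambda>i. if i \<in> G \<union> H then 1 else 0) \<and> classified h n A L a i G H)"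
  obtain s' where s': "runs \<delta> (for_loop classify_body) s ((n + 1) * (ctime classify_body + 20)) s'" "J n s'"
  proof (rule runs_for_loop[where J = J])
    show "loop_free classify_body" by (simp add: classify_body_def Let_def)
    show "nats s' 0 2 = i \<and> nats s' 0 0 = n" if "J i s'" for i s'
      using that s by (auto simp: J_def)
    show "J 0 (nput 0 2 0 s)"
      unfolding J_def using s nonneg
      by (intro exI[of _ "{}"]) (auto simp: classified_0)
    show "J (Suc i) (run \<delta> (Seq classify_body (nset 2 (NAdd (nvar 2) (NConst 1)))) s')"
      if i: "i < n" and J: "J i s'" for i s'
    proof -
      obtain G H where *: "nats s' 0 = (nats s 0)(2 := i)" "reals s' 1 = reals s 1"
        "reals s' 0 0 = z" "reals s' 0 2 = A" "reals s' 0 3 = L"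
        "reals s' 0 4 = (\<Sum>j\<in>G - {a}. h j)" "reals s' 0 5 = (\<Sum>j\<in>H. h j)" "reals s' 0 6 = real (card G)"
        "nats s' 1 = (\<lambda>i. if i \<in> G \<union> H then 1 else 0)" and cl: "classified h n A L a i G H"
        using J unfolding J_def by blast
      have fin: "finite G" "finite H" "i \<notin> G" "i \<notin> H" using classified_finite[OF cl] by auto
      have hi: "\<delta> i n powr z = h i" "0 \<le> h i" by (simp_all add: h_def)
      consider "i = a" | "i \<noteq> a" "A < L * L * (real n * h i)"
        | "i \<noteq> a" "\<not> A < L * L * (real n * h i)"
          "real n * h i \<le> 2 * A \<and> \<not> (L * A < real n * h i \<and> L * A < (\<Sum>j\<in>G - {a}. h j) + h i)"
        | "i \<noteq> a" "\<not> A < L * L * (real n * h i)"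
          "\<not> (real n * h i \<le> 2 * A \<and> \<not> (L * A < real n * h i \<and> L * A < (\<Sum>j\<in>G - {a}. h j) + h i))"
        by blast
      then show ?thesis
      proof cases
        case 1
        have eq: "insert i G - {a} = G - {a}" using 1 by auto
        show ?thesis
          unfolding J_def
          by (rule exI[of _ "insert i G"], rule exI[of _ H],
            use eq classified_center[OF cl 1 nonneg(1,2)] * s fin 1 in \<open>auto simp: run_classify_body\<close>)
      next
        case 2
        show ?thesis
          unfolding J_def
          by (rule exI[of _ G], rule exI[of _ "insert i H"],
            use 2 classified_far[OF cl 2 nonneg(1,2)] * s fin in \<open>auto simp: run_classify_body hi\<close>)
      next
        case 3
        have "insert i G - {a} = insert i (G - {a})" using 3 by auto
        then have eq: "(\<Sum>j\<in>insert i G - {a}. h j) = (\<Sum>j\<in>G - {a}. h j) + h i" using fin by simp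
        have cl': "classified h n A L a (Suc i) (insert i G) H"
          using 3 nonneg hi i by (intro classified_near[OF cl]) auto
        show ?thesis
          unfolding J_def
          by (rule exI[of _ "insert i G"], rule exI[of _ H],
            use eq cl' * s fin 3 in \<open>auto simp: run_classify_body hi\<close>)
      next
        case 4
        \<comment> \<open>Since L \<le> 1, a point with n h \<le> L A also has n h \<le> 2 A and
          would have been accepted.\<close>
        have "L * A < real n * h i" "real n * h i \<le> 2 * A \<longrightarrow> L * A < (\<Sum>j\<in>G - {a}. h j) + h i"
          using 4(3) mult_right_mono[OF nonneg(3,1)] nonneg(1) by linarith+
        then have cl': "classified h n A L a (Suc i) G H"
          using 4 nonneg by (intro classified_skip[OF cl]) auto
        show ?thesis
          unfolding J_def
          by (rule exI[of _ G], rule exI[of _ H],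
            use cl' * s fin 4 in \<open>auto simp: run_classify_body hi\<close>)
      qed
    qed
  qed
  have "runs \<delta> (for_loop classify_body) s ((n + 1) * 200) s'"
    using s'(1) by (rule runs_mono) (auto simp: classify_body_def Let_def)
  with s'(2) show ?thesis unfolding J_def h_def by (auto intro: that)
qed

lemma runs_fine_prog:
  assumes s: "nats s 0 0 = n" "nats s 0 3 = a" "nats s 0 4 = b" "nats s 0 5 = e"
    "reals s 0 0 = z" "reals s 0 1 = \<epsilon>" "reals s 0 2 = A" "reals s 0 4 = 0" "reals s 0 5 = 0" "reals s 0 6 = 0"
    "nats s 1 = (\<lambda>_. 0)" "reals s 1 = (\<lambda>_. 0)"
    and L: "L = (100 * z / \<epsilon>) powr (- 2 * z)" "L \<le> 1" and A: "0 \<le> A"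
  obtains s' G H where "runs \<delta> fine_prog s ((n + 1) * 200 + 200) s'"
    "classified (\<lambda>i. \<delta> i n powr z) n A L a n G H"
    "nats s' 1 = (\<lambda>i. if i \<in> G \<union> H then 1 else 0)"
    "reals s' 1 = (\<lambda>_. 0)(a := real (card G) + L,
       b := (\<Sum>i\<in>H. \<delta> i n powr z) / \<delta> b n powr z + L, e := L)"
proof -
  let ?p = "rset 3 (RPow (RDiv (RMul (rconst 100) (rvar 0)) (rvar 1))
    (RMul (RSub (rconst 0) (rconst 2)) (rvar 0)))"
  let ?s1 = "rput 0 3 L s"
  have "run \<delta> ?p s = ?s1" using s by (simp add: L)
  then have 1: "runs \<delta> ?p s 50 ?s1"
    using runs_mono[OF runs_loop_free[of ?p \<delta> s], of 50] by simp
  obtain s2 G H where 2: "runs \<delta> (for_loop classify_body) ?s1 ((n + 1) * 200) s2"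
    "classified (\<lambda>i. \<delta> i n powr z) n A L a n G H"
    "nats s2 1 = (\<lambda>i. if i \<in> G \<union> H then 1 else 0)"
    "nats s2 0 = (nats ?s1 0)(2 := n)" "reals s2 1 = reals ?s1 1" "reals s2 0 0 = z" "reals s2 0 3 = L"
    "reals s2 0 5 = (\<Sum>i\<in>H. \<delta> i n powr z)" "reals s2 0 6 = real (card G)"
    by (rule runs_classify_prog[of ?s1 n a z A L \<delta>]) (use s L A in auto)
  let ?u = "RAdd (rvar 6) (rvar 3)"
  let ?v = "RAdd (RDiv (rvar 5) (center_cost (nvar 4))) (rvar 3)"
  obtain s' where 3: "runs \<delta> (weights_prog ?u ?v (rvar 3)) s2 (ctime (weights_prog ?u ?v (rvar 3))) s'"
    "nats s' = nats s2" "reals s' 1 = (\<lambda>_. 0)(a := real (card G) + L,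
       b := (\<Sum>i\<in>H. \<delta> i n powr z) / \<delta> b n powr z + L, e := L)"
    using runs_weights_prog[of s2 a b e \<delta> ?v "rvar 3" ?u] 2 s by auto
  have "runs \<delta> fine_prog s ((n + 1) * 200 + 200) s'"
    unfolding fine_prog_def
    by (rule runs_mono[OF runs_Seq[OF 1 runs_Seq[OF 2(1) 3(1)]]]) (simp add: weights_prog_def)
  with 2 3 show ?thesis by (intro that) auto
qed

lemma runs_coreset_prog:
  fixes \<delta> :: queries and n :: nat
  defines "f \<equiv> \<lambda>i. \<delta> i n"
  assumes L: "L = (100 * z / \<epsilon>) powr (- 2 * z)" "L \<le> 1"
  obtains (tiny) s where "runs \<delta> coreset_prog (init_state n k z \<epsilon>) ((n + 1) * 1000) s"
      "n < 4" "\<forall>i<n. nats s 1 i = 1 \<and> reals s 1 i = 1"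
    | (crude) s a b e where "runs \<delta> coreset_prog (init_state n k z \<epsilon>) ((n + 1) * 1000) s"
      "4 \<le> n" "z < 101 / 100 * \<epsilon>" "extremes f n a b" "e < 3" "e \<noteq> a" "e \<noteq> b"
      "\<forall>i<n. nats s 1 i = 1" "reals s 1 = (\<lambda>_. 0)(a := real n / 10, b := 1 / 100, e := 1 / 100)"
    | (fine) s a b e G H where "runs \<delta> coreset_prog (init_state n k z \<epsilon>) ((n + 1) * 1000) s"
      "4 \<le> n" "101 / 100 * \<epsilon> \<le> z" "extremes f n a b" "e < 3" "e \<noteq> a" "e \<noteq> b"
      "classified (\<lambda>i. f i powr z) n (\<Sum>i<n. f i powr z) L a n G H"
      "nats s 1 = (\<lambda>i. if i \<in> G \<union> H then 1 else 0)"
      "reals s 1 = (\<lambda>_. 0)(a := real (card G) + L, b := (\<Sum>i\<in>H. f i powr z) / f b powr z + L, e := L)"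
proof (cases "n < 4")
  case True
  let ?s = "init_state n k z \<epsilon>"
  have [simp]: "nats ?s 0 0 = n" by (simp add: init_state_def)
  obtain s where s: "runs \<delta> tiny_prog ?s ((n + 1) * 100) s" "\<forall>i<n. nats s 1 i = 1 \<and> reals s 1 i = 1"
    by (rule runs_tiny_prog[of ?s n \<delta>]) auto
  have "runs \<delta> coreset_prog ?s (btime (NLess (nvar 0) (NConst 4)) + (n + 1) * 100 + 1) s"
    unfolding coreset_prog_def using True s(1) by (intro runs_Cond) simp
  then show ?thesis using s True by (intro tiny) (auto elim: runs_mono)
next
  case False
  let ?s = "init_state n k z \<epsilon>"
  have s [simp]: "nats ?s 0 = (\<lambda>_. 0)(0 := n, 1 := k)" "reals ?s 0 = (\<lambda>_. 0)(0 := z, 1 := \<epsilon>)"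
    "nats ?s (Suc 0) = (\<lambda>_. 0)" "reals ?s (Suc 0) = (\<lambda>_. 0)"
    by (simp_all add: init_state_def)
  define A where "A = (\<Sum>i<n. f i powr z)"
  have A: "0 \<le> A" by (simp add: A_def sum_nonneg)
  obtain s1 a b where 1: "runs \<delta> extremes_prog ?s ((n + 1) * 100) s1"
    "nats s1 0 0 = n" "nats s1 0 3 = a" "nats s1 0 4 = b" "extremes f n a b"
    "nats s1 1 = nats ?s 1" "reals s1 1 = reals ?s 1" "reals s1 0 = (reals ?s 0)(2 := A)"
    unfolding f_def A_def by (rule runs_extremes_prog[of ?s n z \<delta>]) auto
  have "a \<noteq> b" using 1(5) False by (auto simp: extremes_def)
  then obtain s2 e where 2: "runs \<delta> third_prog s1 100 s2" "e < 3" "e \<noteq> a" "e \<noteq> b"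
    "nats s2 0 = (nats s1 0)(5 := e)" "nats s2 1 = nats s1 1" "reals s2 = reals s1"
    using runs_third_prog[OF 1(3,4)] by metis
  let ?b = "RLess (rvar 0) (RMul (RDiv (rconst 101) (rconst 100)) (rvar 1))"
  have b: "bval \<delta> ?b s2 \<longleftrightarrow> z < 101 / 100 * \<epsilon>" using 1 2 by simp
  have seq: "runs \<delta> coreset_prog ?s ((n + 1) * 1000) s"
    if "runs \<delta> (if bval \<delta> ?b s2 then crude_prog else fine_prog) s2 ((n + 1) * 200 + 200) s" for s
  proof -
    have *: "\<not> bval \<delta> (NLess (nvar 0) (NConst 4)) ?s" using False by simp
    have "runs \<delta> (if bval \<delta> (NLess (nvar 0) (NConst 4)) ?s then tiny_prog
        else Seq extremes_prog (Seq third_prog (Cond ?b crude_prog fine_prog))) ?s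
        ((n + 1) * 100 + (100 + (btime ?b + ((n + 1) * 200 + 200) + 1))) s"
      unfolding if_not_P[OF *] by (intro runs_Seq[OF 1(1)] runs_Seq[OF 2(1)] runs_Cond that)
    from runs_Cond[OF this] show ?thesis
      unfolding coreset_prog_def using False by (auto elim!: runs_mono)
  qed
  show ?thesis
  proof (cases "z < 101 / 100 * \<epsilon>")
    case True
    obtain s where "runs \<delta> crude_prog s2 ((n + 1) * 100 + 100) s" "\<forall>i<n. nats s 1 i = 1"
      "reals s 1 = (\<lambda>_. 0)(a := real n / 10, b := 1 / 100, e := 1 / 100)"
      by (rule runs_crude_prog[of s2 n a b e \<delta>]) (use 1 2 in auto)
    then show ?thesis using True b False 1(5) 2(2-4)
      by (intro crude[of s a b e] seq) (auto elim: runs_mono)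
  next
    case big: False
    obtain s G H where "runs \<delta> fine_prog s2 ((n + 1) * 200 + 200) s"
      "classified (\<lambda>i. f i powr z) n A L a n G H"
      "nats s 1 = (\<lambda>i. if i \<in> G \<union> H then 1 else 0)"
      "reals s 1 = (\<lambda>_. 0)(a := real (card G) + L, b := (\<Sum>i\<in>H. f i powr z) / f b powr z + L, e := L)"
      unfolding f_def by (rule runs_fine_prog[of s2 n a b e z \<epsilon> A L \<delta>]) (use 1 2 L A in auto)
    then show ?thesis using big b False 1(5) 2(2-4)
      by (intro fine[of s a b e G H] seq) (auto simp: A_def)
  qed
qed

section \<open>Correctness\<close>

text \<open>The interval from \<rho> to \<rho> 2^m is cut at the points \<rho> 2^j.\<close>

lemma dyadic_ring:
  fixes \<rho> x :: real
  assumes "\<rho> < x" "x \<le> \<rho> * 2 ^ m"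
  shows "\<exists>j<m. \<rho> * 2 ^ j < x \<and> x \<le> 2 * (\<rho> * 2 ^ j)"
  using assms
proof (induction m)
  case (Suc m)
  show ?case
  proof (cases "x \<le> \<rho> * 2 ^ m")
    case True
    with Suc show ?thesis by (meson less_SucI)
  next
    case False
    with Suc show ?thesis by (intro exI[of _ m]) auto
  qed
qed simp

lemma sum_three_weights:
  fixes h :: "nat \<Rightarrow> real"
  assumes "a < n" "b < n" "e < n" "a \<noteq> b" "e \<noteq> a" "e \<noteq> b"
  shows "(\<Sum>i<n. ((\<lambda>_. 0)(a := u, b := v, e := w)) i * h i) = u * h a + v * h b + w * h e"
proof -
  have "(\<Sum>i<n. ((\<lambda>_. 0)(a := u, b := v, e := w)) i * h i) =
      (\<Sum>i\<in>{a, b, e}. ((\<lambda>_. 0)(a := u, b := v, e := w)) i * h i)"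
    using assms by (intro sum.mono_neutral_right) auto
  then show ?thesis using assms by simp
qed

lemma card_three_weights:
  fixes u v w :: real
  assumes "a < n" "b < n" "e < n" "a \<noteq> b" "e \<noteq> a" "e \<noteq> b" "0 < u" "0 < v" "0 < w"
  shows "card {i. i < n \<and> ((\<lambda>_. 0)(a := u, b := v, e := w)) i \<noteq> 0} = 3"
proof -
  have "{i. i < n \<and> ((\<lambda>_. 0)(a := u, b := v, e := w)) i \<noteq> 0} = {a, b, e}"
    using assms by auto
  then show ?thesis using assms by simp
qed

text \<open>All guarantees except the running time; \<open>M\<close> is the bound on the number of
  rings.\<close>

definition ring_coreset_output ::
  "'a set \<Rightarrow> ('a \<Rightarrow> 'a \<Rightarrow> real) \<Rightarrow> real \<Rightarrow> real \<Rightarrow> real \<Rightarrow> 'a list \<Rightarrow> 'a \<Rightarrow> state \<Rightarrow> bool" where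
  "ring_coreset_output X d z \<epsilon> M xs c s \<longleftrightarrow>
     (\<exists>W Z S w. outputs xs s W Z S w \<and> W \<union> Z = set xs \<and> W \<inter> Z = {} \<and>
       S \<subseteq> set xs \<and> weighted_set S w \<and> card S = min 3 (length xs) \<and>
       (\<exists>(m :: nat) R r. real m \<le> M \<and> W = (\<Union>i<m. R i) \<and>
         (\<forall>i<m. 0 < r i \<and> R i \<subseteq> metric_ring X d c (r i) (2 * r i))) \<and>
       is_coreset X d z \<epsilon> (cost d z (set xs) c) Z S w)"

text \<open>As \<open>xs\<close> is distinct, handles and points correspond bijectively: costs
  become sums over handles, and the weight function is read through the inverse of the listing. The
  distances of W lie in one dyadic range, which \<open>dyadic_ring\<close> cuts into
  \<open>m\<close> rings.\<close>

lemma ring_coreset_outputI: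
  assumes X: "Metric_space X d" "set xs \<subseteq> X" "distinct xs" "c \<in> X"
    and n: "n = length xs"
    and labels: "\<And>i. i < n \<Longrightarrow> nats s 1 i = 0 \<or> nats s 1 i = 1"
    and weights: "\<And>i. i < n \<Longrightarrow> 0 \<le> reals s 1 i" "card {i. i < n \<and> reals s 1 i \<noteq> 0} = min 3 n"
    and rings: "real m \<le> M" "0 < \<rho>"
      "\<And>i. i < n \<Longrightarrow> nats s 1 i = 0 \<Longrightarrow> \<rho> < d (xs ! i) c \<and> d (xs ! i) c \<le> \<rho> * 2 ^ m"
    and error: "\<And>y. y \<in> X \<Longrightarrow>
      \<bar>(\<Sum>i | i < n \<and> nats s 1 i = 1. d (xs ! i) y powr z) - (\<Sum>i<n. reals s 1 i * d (xs ! i) y powr z)\<bar>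
      \<le> \<epsilon> * ((\<Sum>i | i < n \<and> nats s 1 i = 1. d (xs ! i) y powr z) + (\<Sum>i<n. d (xs ! i) c powr z))"
  shows "ring_coreset_output X d z \<epsilon> M xs c s"
proof -
  have inj: "inj_on ((!) xs) I" if "I \<subseteq> {..<n}" for I
    using X(3) that n by (auto simp: inj_on_def nth_eq_iff_index_eq subset_eq)
  define w where "w = (\<lambda>x. reals s 1 (the_inv_into {..<n} ((!) xs) x))"
  have w: "w (xs ! i) = reals s 1 i" if "i < n" for i
    using that inj[of "{..<n}"] by (simp add: w_def the_inv_into_f_f)
  define B where "B = (\<lambda>P. {xs ! i | i. i < n \<and> P i})"
  have B_image: "B P = (!) xs ` {i. i < n \<and> P i}" for P by (auto simp: B_def)
  have B_all: "set xs = B (\<lambda>_. True)" using n by (auto simp: B_def set_conv_nth)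
  have sum_B: "(\<Sum>x\<in>B P. h x) = (\<Sum>i | i < n \<and> P i. h (xs ! i))" for P and h :: "'a \<Rightarrow> real"
    unfolding B_image by (subst sum.reindex) (auto intro!: inj)
  define W where "W = B (\<lambda>i. nats s 1 i = 0)"
  define Z where "Z = B (\<lambda>i. nats s 1 i = 1)"
  define S where "S = B (\<lambda>i. reals s 1 i \<noteq> 0)"
  have out: "outputs xs s W Z S w"
    using w by (simp add: outputs_def W_def Z_def S_def B_def n)
  have union: "W \<union> Z = set xs"
    using labels unfolding W_def Z_def B_all B_def by blast
  have "(!) xs ` {i. i < n \<and> nats s 1 i = 0} \<inter> (!) xs ` {i. i < n \<and> nats s 1 i = 1}
      = (!) xs ` ({i. i < n \<and> nats s 1 i = 0} \<inter> {i. i < n \<and> nats s 1 i = 1})"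
    by (rule inj_on_image_Int[OF inj[of "{..<n}"], symmetric]) auto
  then have disj: "W \<inter> Z = {}"
    unfolding W_def Z_def B_image by auto
  have S: "S \<subseteq> set xs" unfolding S_def B_all B_def by auto
  have wS: "weighted_set S w"
    using w weights(1) by (force simp: weighted_set_def S_def B_def)
  have cS: "card S = min 3 n"
    unfolding S_def B_image weights(2)[symmetric] by (intro card_image inj) auto
  have "W = (\<Union>j<m. W \<inter> metric_ring X d c (\<rho> * 2 ^ j) (2 * (\<rho> * 2 ^ j)))"
  proof
    show "W \<subseteq> (\<Union>j<m. W \<inter> metric_ring X d c (\<rho> * 2 ^ j) (2 * (\<rho> * 2 ^ j)))"
    proof
      fix x assume x: "x \<in> W"
      then obtain i where i: "x = xs ! i" "i < n" "nats s 1 i = 0" by (auto simp: W_def B_def)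
      obtain j where "j < m" "\<rho> * 2 ^ j < d x c" "d x c \<le> 2 * (\<rho> * 2 ^ j)"
        using dyadic_ring[of \<rho> "d x c" m] rings(3)[OF i(2,3)] i(1) by auto
      moreover have "x \<in> X" using i n X(2) by auto
      ultimately show "x \<in> (\<Union>j<m. W \<inter> metric_ring X d c (\<rho> * 2 ^ j) (2 * (\<rho> * 2 ^ j)))"
        using x by (auto simp: metric_ring_def)
    qed
  qed auto
  then have ring: "\<exists>(m :: nat) R r. real m \<le> M \<and> W = (\<Union>i<m. R i) \<and>
      (\<forall>i<m. 0 < r i \<and> R i \<subseteq> metric_ring X d c (r i) (2 * r i))"
    using rings(1,2) by (intro exI[of _ m] exI[of _ "\<lambda>j. W \<inter> metric_ring X d c (\<rho> * 2 ^ j) (2 * (\<rho> * 2 ^ j))"]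
      exI[of _ "\<lambda>j. \<rho> * 2 ^ j"]) auto
  have cost_Z: "cost d z Z y = (\<Sum>i | i < n \<and> nats s 1 i = 1. d (xs ! i) y powr z)" for y
    unfolding wcost_def Z_def sum_B by simp
  have cost_P: "cost d z (set xs) c = (\<Sum>i<n. d (xs ! i) c powr z)"
    unfolding wcost_def B_all sum_B by (simp add: lessThan_def)
  have cost_S: "wcost d z S w y = (\<Sum>i<n. reals s 1 i * d (xs ! i) y powr z)" for y
  proof -
    have "wcost d z S w y = (\<Sum>i | i < n \<and> reals s 1 i \<noteq> 0. w (xs ! i) * d (xs ! i) y powr z)"
      unfolding wcost_def S_def sum_B ..
    also have "\<dots> = (\<Sum>i | i < n \<and> reals s 1 i \<noteq> 0. reals s 1 i * d (xs ! i) y powr z)"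
      using w by (intro sum.cong) auto
    also have "\<dots> = (\<Sum>i<n. reals s 1 i * d (xs ! i) y powr z)"
      by (intro sum.mono_neutral_left) auto
    finally show ?thesis .
  qed
  have coreset: "is_coreset X d z \<epsilon> (cost d z (set xs) c) Z S w"
    unfolding is_coreset_def cost_Z cost_P cost_S using wS error by auto
  show ?thesis
    unfolding ring_coreset_output_def
    by (rule exI[of _ W], rule exI[of _ Z], rule exI[of _ S], rule exI[of _ w])
      (intro conjI out union disj S wS cS[unfolded n] ring coreset)
qed

text \<open>By the choice of \<rho> the bounds \<open>low\<close> and \<open>high\<close> say
  \<rho>^z < x^z \<le> \<rho>^z / L^3, and L^(-3) = Q^(6z).\<close>

lemma ring_radii:
  fixes z \<epsilon> x A :: real and n :: nat
  defines "Q \<equiv> 100 * z / \<epsilon>"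
  defines "L \<equiv> Q powr (- 2 * z)"
  defines "\<rho> \<equiv> (L * A / real n) powr (1 / z)"
  assumes z: "1 \<le> z" "0 < \<epsilon>" and A: "0 < A" "0 < n" and x: "0 \<le> x"
    and low: "L * A < real n * x powr z" and high: "L * L * (real n * x powr z) \<le> A"
  shows "\<rho> < x" "x \<le> \<rho> * Q ^ 6"
proof -
  have Q: "0 < Q" using z by (simp add: Q_def)
  have L: "0 < L" using Q by (simp add: L_def)
  have rz: "\<rho> powr z = L * A / real n"
    using z A L by (simp add: \<rho>_def powr_powr)
  have r0: "0 < \<rho>" using A L by (simp add: \<rho>_def)
  have "\<rho> powr z < x powr z" using low A by (simp add: rz field_simps)
  then show "\<rho> < x" using powr_mono2[of z x \<rho>] z x by (meson less_le_not_le linear not_less order_trans zero_le_one)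
  have "(Q ^ 6) powr z = Q powr (6 * z)"
    using Q by (simp add: powr_powr flip: powr_numeral)
  also have "\<dots> = 1 / (L * L * L)"
    by (simp add: L_def powr_minus_divide flip: powr_add)
  finally have "(\<rho> * Q ^ 6) powr z = L * A / real n / (L * L * L)"
    using Q r0 by (simp add: powr_mult rz)
  also have "\<dots> = A / (L * L * real n)" using L by simp
  also have "\<dots> \<ge> x powr z" using high A L by (simp add: field_simps)
  finally have le: "x powr z \<le> (\<rho> * Q ^ 6) powr z" .
  show "x \<le> \<rho> * Q ^ 6"
  proof (rule ccontr)
    assume "\<not> x \<le> \<rho> * Q ^ 6"
    then have "(\<rho> * Q ^ 6) powr z < x powr z"
      using z Q r0 by (intro powr_less_mono2) auto
    with le show False by simp
  qed
qed

text \<open>The factor 100 and the rounding contribute an additive constant. It becomes a multiple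
  of ln q only because ln q is bounded away from 0, which is why z/\<epsilon> close to 1 is treated
  separately.\<close>

lemma ring_count:
  fixes q :: real
  assumes "101 / 100 \<le> q"
  obtains m :: nat where "(100 * q) ^ 6 \<le> 2 ^ m"
    "real m \<le> ((6 * ln 100 / ln 2 + 1) / ln (101 / 100) + 6 / ln 2) * ln q"
proof
  define m where "m = nat \<lceil>6 * log 2 (100 * q)\<rceil>"
  have pos: "0 \<le> 6 * log 2 (100 * q)" using assms by simp
  have m: "6 * log 2 (100 * q) \<le> real m" "real m \<le> 6 * log 2 (100 * q) + 1"
    using pos unfolding m_def by linarith+
  have "(100 * q) ^ 6 = 2 powr (6 * log 2 (100 * q))"
    using assms by (simp add: mult.commute[of 6] flip: powr_powr)
  also have "\<dots> \<le> 2 powr real m" using m by (intro powr_mono) auto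
  finally show "(100 * q) ^ 6 \<le> 2 ^ m" by (simp add: powr_realpow)
  have ln: "ln (101 / 100) \<le> ln q" "0 < ln (101 / 100 :: real)" using assms by auto
  have "real m \<le> (6 * ln 100 / ln 2 + 1) * 1 + 6 / ln 2 * ln q"
    using m assms by (simp add: log_def ln_mult add_divide_distrib algebra_simps)
  also have "\<dots> \<le> (6 * ln 100 / ln 2 + 1) * (ln q / ln (101 / 100)) + 6 / ln 2 * ln q"
    using ln by (intro add_right_mono mult_left_mono) (auto simp: field_simps)
  finally show "real m \<le> ((6 * ln 100 / ln 2 + 1) / ln (101 / 100) + 6 / ln 2) * ln q"
    by (simp add: algebra_simps)
qed

lemma coreset_prog_correct:
  assumes X: "Metric_space X d" "set xs \<subseteq> X" "distinct xs" "c \<in> X"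
    and z: "1 \<le> z" and eps: "0 < \<epsilon>" "\<epsilon> < 1" and n: "n = length xs"
    and K: "K = (6 * ln 100 / ln 2 + 1) / ln (101 / 100) + 6 / ln 2"
  shows "\<exists>s. runs (handle_dist d xs c) coreset_prog (init_state n k z \<epsilon>) ((n + 1) * 1000) s \<and>
    ring_coreset_output X d z \<epsilon> (K * ln (z / \<epsilon>)) xs c s"
proof -
  interpret Metric_space X d by (rule X(1))
  define L where "L = (100 * z / \<epsilon>) powr (- 2 * z)"
  have q: "1 \<le> z / \<epsilon>" using z eps by simp
  have K0: "real 0 \<le> K * ln (z / \<epsilon>)" using q by (simp add: K)
  have "(100 * z / \<epsilon>) powr (- 2 * z) \<le> (100 * z / \<epsilon>) powr (- 1)"
    using z q by (intro powr_mono) auto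
  also have "\<dots> = 1 / (100 * z / \<epsilon>)"
    using z eps by (subst powr_minus_divide) simp
  also have "\<dots> \<le> 1 / 100"
    using z eps by (simp add: field_simps)
  finally have L: "0 < L" "L \<le> 1 / 100"
    using z eps by (simp_all add: L_def)
  define f where "f = (\<lambda>i. handle_dist d xs c i n)"
  have f_app: "handle_dist d xs c i n = f i" for i by (simp add: f_def)
  have f: "f i = d (xs ! i) c" if "i < n" for i
    using that n by (simp add: f_def handle_dist_def nth_append)
  have inX: "xs ! i \<in> X" if "i < n" for i using that n X(2) by auto
  have star: "star_distances n f (\<lambda>i. d (xs ! i) y) (d c y) z \<epsilon> a b e"
    if "y \<in> X" "extremes f n a b" "4 \<le> n" "e < 3" for y a b e
  proof
    have ab: "a < n" "b < n" "\<And>i. i < n \<Longrightarrow> f a \<le> f i \<and> f i \<le> f b"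
      using that by (auto simp: extremes_def)
    then show "a < n" "b < n" "e < n" using that by auto
    show "f a \<le> f i" "f i \<le> f b" if "i < n" for i using ab that by auto
    show "d (xs ! i) y \<le> f i + d c y" "f i \<le> d (xs ! i) y + d c y" "d c y \<le> f i + d (xs ! i) y"
      if "i < n" for i
      using inX[OF that] \<open>y \<in> X\<close> X(4) triangle commute f[OF that] by metis+
    \<comment> \<open>The path from one point to y leads through c and the other point.\<close>
    show "d (xs ! i) y \<le> d (xs ! j) y + (f i + f j)" if "i < n" "j < n" for i j
      using triangle[of "xs ! i" c y] triangle[of c "xs ! j" y] inX that \<open>y \<in> X\<close> X(4) commute[of c "xs ! j"] f
      by (smt (verit))
  qed (use z eps f in auto)
  show ?thesis
  proof (rule runs_coreset_prog[of L z \<epsilon> "handle_dist d xs c" n k, unfolded f_app])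
    show "L = (100 * z / \<epsilon>) powr (- 2 * z)" "L \<le> 1" using L by (auto simp: L_def)
  next
    fix s
    assume s: "runs (handle_dist d xs c) coreset_prog (init_state n k z \<epsilon>) ((n + 1) * 1000) s"
      "n < 4" "\<forall>i<n. nats s 1 i = 1 \<and> reals s 1 i = 1"
    have *: "{i. i < n \<and> nats s 1 i = 1} = {..<n}" "{i. i < n \<and> reals s 1 i \<noteq> 0} = {..<n}"
      using s(3) by auto
    have err: "\<bar>(\<Sum>i | i < n \<and> nats s 1 i = 1. d (xs ! i) y powr z) - (\<Sum>i<n. reals s 1 i * d (xs ! i) y powr z)\<bar>
      \<le> \<epsilon> * ((\<Sum>i | i < n \<and> nats s 1 i = 1. d (xs ! i) y powr z) + (\<Sum>i<n. d (xs ! i) c powr z))" for y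
    proof -
      have "(\<Sum>i<n. reals s 1 i * d (xs ! i) y powr z) = (\<Sum>i<n. d (xs ! i) y powr z)"
        using s(3) by (intro sum.cong) auto
      then show ?thesis unfolding * using eps by (simp add: sum_nonneg)
    qed
    \<comment> \<open>W is empty, so there are no rings and the base radius 1 is arbitrary.\<close>
    show ?thesis
      by (intro exI[of _ s] conjI s(1), rule ring_coreset_outputI[OF X n, where \<rho> = 1 and m = 0])
        (use s(2,3) K0 * err in auto)
  next
    fix s a b e
    assume s: "runs (handle_dist d xs c) coreset_prog (init_state n k z \<epsilon>) ((n + 1) * 1000) s"
      "4 \<le> n" "z < 101 / 100 * \<epsilon>" "extremes f n a b" "e < 3" "e \<noteq> a" "e \<noteq> b"
      "\<forall>i<n. nats s 1 i = 1" "reals s 1 = (\<lambda>_. 0)(a := real n / 10, b := 1 / 100, e := 1 / 100)"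
    have abe: "a < n" "b < n" "e < n" "a \<noteq> b" using s by (auto simp: extremes_def)
    have *: "{i. i < n \<and> nats s 1 i = 1} = {..<n}" using s(8) by auto
    have "card {i. i < n \<and> reals s 1 i \<noteq> 0} = 3"
      unfolding s(9) using abe s by (intro card_three_weights) auto
    then have card: "card {i. i < n \<and> reals s 1 i \<noteq> 0} = min 3 n" using s(2) by simp
    have err: "\<bar>(\<Sum>i | i < n \<and> nats s 1 i = 1. d (xs ! i) y powr z) - (\<Sum>i<n. reals s 1 i * d (xs ! i) y powr z)\<bar>
      \<le> \<epsilon> * ((\<Sum>i | i < n \<and> nats s 1 i = 1. d (xs ! i) y powr z) + (\<Sum>i<n. d (xs ! i) c powr z))"
      if "y \<in> X" for y
      using star_distances.crude_coreset[OF star[OF that s(4,2,5)] s(3)] f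
      unfolding s(9) * sum_three_weights[OF abe s(6,7)] by simp
    show ?thesis
      by (intro exI[of _ s] conjI s(1), rule ring_coreset_outputI[OF X n _ _ card, where \<rho> = 1 and m = 0])
        (use s(8,9) K0 err in auto)
  next
    fix s a b e G H
    assume s: "runs (handle_dist d xs c) coreset_prog (init_state n k z \<epsilon>) ((n + 1) * 1000) s"
      "4 \<le> n" "101 / 100 * \<epsilon> \<le> z" "extremes f n a b" "e < 3" "e \<noteq> a" "e \<noteq> b"
      "classified (\<lambda>i. f i powr z) n (\<Sum>i<n. f i powr z) L a n G H"
      "nats s 1 = (\<lambda>i. if i \<in> G \<union> H then 1 else 0)"
      "reals s 1 = (\<lambda>_. 0)(a := real (card G) + L, b := (\<Sum>i\<in>H. f i powr z) / f b powr z + L, e := L)"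
    have abe: "a < n" "b < n" "e < n" "a \<noteq> b" using s by (auto simp: extremes_def)
    define A where "A = (\<Sum>i<n. f i powr z)"
    note cl = s(8)[folded A_def, unfolded classified_def]
    \<comment> \<open>Of two distinct points one differs from c, which makes A positive.\<close>
    have "0 < length xs" "1 < length xs" using s(2) n by auto
    then have "xs ! 0 \<noteq> xs ! 1" using nth_eq_iff_index_eq[OF X(3)] by (metis zero_neq_one)
    then obtain i where i: "i < n" "xs ! i \<noteq> c"
      using that[of 0] that[of 1] s(2) by (cases "xs ! 0 = c") auto
    then have "0 < f i" using f inX X(4) by (simp add: mdist_pos_less)
    then have A: "0 < A" unfolding A_def using i by (intro sum_pos2[of _ i]) auto
    have *: "{i. i < n \<and> nats s 1 i = 1} = G \<union> H" using s(9) cl by auto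
    have w_pos: "0 < real (card G) + L" "0 < (\<Sum>i\<in>H. f i powr z) / f b powr z + L"
      using L by (auto intro!: add_nonneg_pos divide_nonneg_nonneg sum_nonneg)
    have "card {i. i < n \<and> reals s 1 i \<noteq> 0} = 3"
      unfolding s(10) using abe s w_pos L by (intro card_three_weights) auto
    then have card: "card {i. i < n \<and> reals s 1 i \<noteq> 0} = min 3 n" using s(2) by simp
    have err: "\<bar>(\<Sum>i | i < n \<and> nats s 1 i = 1. d (xs ! i) y powr z) - (\<Sum>i<n. reals s 1 i * d (xs ! i) y powr z)\<bar>
      \<le> \<epsilon> * ((\<Sum>i | i < n \<and> nats s 1 i = 1. d (xs ! i) y powr z) + (\<Sum>i<n. d (xs ! i) c powr z))"
      if "y \<in> X" for y
    proof -
      have "\<bar>(\<Sum>i\<in>G \<union> H. d (xs ! i) y powr z) - ((real (card G) + L) * d (xs ! a) y powr z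
          + ((\<Sum>i\<in>H. f i powr z) / f b powr z + L) * d (xs ! b) y powr z + L * d (xs ! e) y powr z)\<bar>
        \<le> \<epsilon> * ((\<Sum>i\<in>G \<union> H. d (xs ! i) y powr z) + A)"
        unfolding A_def
      proof (rule star_distances.fine_coreset[OF star[OF that s(4,2,5)] L_def])
        show "i \<in> G \<or> L * (\<Sum>i<n. f i powr z) < (\<Sum>i\<in>G - {a}. f i powr z) + f i powr z"
          if i: "i < n" "real n * f i powr z \<le> 2 * (\<Sum>i<n. f i powr z)" for i
        proof (cases "i \<in> H")
          case True
          \<comment> \<open>Such a point cannot be in \<open>H\<close>: this would give A < 2 L^2 A,
            although L \<le> 1/100.\<close>
          have "A < L * L * (real n * f i powr z)" using cl True by auto
          also have "\<dots> \<le> L * L * (2 * A)" using i by (intro mult_left_mono) (auto simp: A_def)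
          also have "\<dots> \<le> (1 / 100) * (1 / 100) * (2 * A)"
            using L A by (intro mult_right_mono mult_mono) auto
          finally show ?thesis using A by simp
        qed (use i cl in \<open>auto simp: A_def\<close>)
        show "(\<Sum>i\<in>G - {a}. f i powr z) \<le> 2 * L * (\<Sum>i<n. f i powr z)"
          using cl abe unfolding A_def by simp
      qed (use cl A abe in \<open>auto simp: A_def power2_eq_square\<close>)
      then show ?thesis
        unfolding s(10) * sum_three_weights[OF abe s(6,7)] A_def using f by simp
    qed
    have "101 / 100 \<le> z / \<epsilon>" using s(3) eps by (simp add: field_simps)
    then obtain m :: nat where m: "(100 * (z / \<epsilon>)) ^ 6 \<le> 2 ^ m" "real m \<le> K * ln (z / \<epsilon>)"
      unfolding K by (rule ring_count)
    define \<rho> where "\<rho> = (L * A / real n) powr (1 / z)"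
    have \<rho>: "0 < \<rho>" using L A s(2) by (simp add: \<rho>_def)
    have ring: "\<rho> < d (xs ! i) c \<and> d (xs ! i) c \<le> \<rho> * 2 ^ m" if i: "i < n" "nats s 1 i = 0" for i
    proof -
      have "i \<notin> G \<union> H" using i s(9) by (auto split: if_splits)
      then have lh: "L * A < real n * f i powr z" "L * L * (real n * f i powr z) \<le> A"
        using cl i by auto
      have "\<rho> < f i" "f i \<le> \<rho> * (100 * z / \<epsilon>) ^ 6"
        using ring_radii[of z \<epsilon> A n "f i"] lh z eps A i f by (auto simp: \<rho>_def L_def)
      moreover have "\<rho> * (100 * z / \<epsilon>) ^ 6 \<le> \<rho> * 2 ^ m" using m \<rho> by simp
      ultimately show ?thesis using f[OF i(1)] by simp
    qed
    show ?thesis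
      by (intro exI[of _ s] conjI s(1), rule ring_coreset_outputI[OF X n _ _ card m(2) \<rho> ring err])
        (use s(9,10) w_pos L in auto)
  qed
qed

theorem theorem3p3:
  "\<exists>(prog :: com) (K :: real) (C :: real) (a :: nat).
     \<forall>(X :: 'a set) (d :: 'a \<Rightarrow> 'a \<Rightarrow> real) (z :: real) (k :: nat).
       Metric_space X d \<and> 1 \<le> z \<and> 1 \<le> k \<longrightarrow>
       (\<forall>(P :: 'a set) (xs :: 'a list) (c :: 'a) (\<epsilon> :: real).
          finite P \<and> P \<subseteq> X \<and> set xs = P \<and> distinct xs \<and> c \<in> X \<and> 0 < \<epsilon> \<and> \<epsilon> < 1 \<longrightarrow>
          (\<exists>(t :: nat) (s :: state) (W :: 'a set) (Z :: 'a set) (S :: 'a set) (w :: 'a \<Rightarrow> real).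
             exec (handle_dist d xs c) prog (init_state (card P) k z \<epsilon>) t s \<and>
             outputs xs s W Z S w \<and>
             W \<union> Z = P \<and> W \<inter> Z = {} \<and>
             S \<subseteq> P \<and> weighted_set S w \<and> card S = min 3 (card P) \<and>
             (\<exists>(m :: nat) (R :: nat \<Rightarrow> 'a set) (r :: nat \<Rightarrow> real).
                real m \<le> K * ln (z / \<epsilon>) \<and>
                W = (\<Union>i<m. R i) \<and>
                (\<forall>i<m. 0 < r i \<and> R i \<subseteq> metric_ring X d c (r i) (2 * r i))) \<and>
             is_coreset X d z \<epsilon> (cost d z P c) Z S w \<and>
             real t \<le> C * real (max 1 (card P * k)) * (1 + ln (real (max 1 (card P * k)))) ^ a))"
proof -
  define K :: real where "K = (6 * ln 100 / ln 2 + 1) / ln (101 / 100) + 6 / ln 2"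
  show ?thesis
  \<comment> \<open>The running time is linear, so the exponent 0 of the logarithm works;
    \<open>K\<close> is the constant of \<open>ring_count\<close>. As k \<ge> 1, the bound 1000 (n +
    1) is at most 2000 max(1, n k), also for n = 0.\<close>
  proof (rule exI[of _ coreset_prog], rule exI[of _ K], rule exI[of _ 2000], rule exI[of _ 0],
      intro allI impI, elim conjE)
    fix X P :: "'a set" and d and z \<epsilon> :: real and k :: nat and xs c
    assume X: "Metric_space X d" "1 \<le> z" "1 \<le> k" "finite P" "P \<subseteq> X" "set xs = P" "distinct xs" "c \<in> X"
      "0 < \<epsilon>" "\<epsilon> < 1"
    have n: "card P = length xs" using X(6,7) distinct_card by blast
    have "set xs \<subseteq> X" using X by simp
    from coreset_prog_correct[OF X(1) this X(7,8,2,9,10) n K_def, of k]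
    obtain s t where t: "t \<le> (card P + 1) * 1000"
      and exec: "exec (handle_dist d xs c) coreset_prog (init_state (card P) k z \<epsilon>) t s"
      and out: "ring_coreset_output X d z \<epsilon> (K * ln (z / \<epsilon>)) xs c s"
      unfolding runs_def by blast
    from out[unfolded ring_coreset_output_def X(6), folded n] obtain W Z S w where
      *: "outputs xs s W Z S w \<and> W \<union> Z = P \<and> W \<inter> Z = {} \<and> S \<subseteq> P \<and> weighted_set S w \<and>
        card S = min 3 (card P) \<and>
        (\<exists>(m :: nat) R r. real m \<le> K * ln (z / \<epsilon>) \<and> W = (\<Union>i<m. R i) \<and>
          (\<forall>i<m. 0 < r i \<and> R i \<subseteq> metric_ring X d c (r i) (2 * r i))) \<and>
        is_coreset X d z \<epsilon> (cost d z P c) Z S w"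
      by (elim exE)
    have "card P \<le> card P * k" using X(3) by simp
    then have "card P \<le> max 1 (card P * k)" "1 \<le> max 1 (card P * k)"
      by (simp_all only: le_max_iff_disj order_refl simp_thms)
    moreover have "t \<le> 2000 * N" if "card P \<le> N" "1 \<le> N" for N using that t by simp
    ultimately have "t \<le> 2000 * max 1 (card P * k)" by blast
    then have "real t \<le> real (2000 * max 1 (card P * k))" by (rule of_nat_mono)
    then have time: "real t \<le> 2000 * real (max 1 (card P * k)) * (1 + ln (real (max 1 (card P * k)))) ^ 0"
      by simp
    show "\<exists>t s W Z S w. exec (handle_dist d xs c) coreset_prog (init_state (card P) k z \<epsilon>) t s \<and>
        outputs xs s W Z S w \<and> W \<union> Z = P \<and> W \<inter> Z = {} \<and> S \<subseteq> P \<and> weighted_set S w \<and>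
        card S = min 3 (card P) \<and>
        (\<exists>(m :: nat) R r. real m \<le> K * ln (z / \<epsilon>) \<and> W = (\<Union>i<m. R i) \<and>
          (\<forall>i<m. 0 < r i \<and> R i \<subseteq> metric_ring X d c (r i) (2 * r i))) \<and>
        is_coreset X d z \<epsilon> (cost d z P c) Z S w \<and>
        real t \<le> 2000 * real (max 1 (card P * k)) * (1 + ln (real (max 1 (card P * k)))) ^ 0"
      by (rule exI[of _ t], rule exI[of _ s], rule exI[of _ W], rule exI[of _ Z], rule exI[of _ S],
        rule exI[of _ w], insert * exec time, elim conjE, intro conjI) assumption+
  qed
qed

end
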